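(* Let $\Gamma$ be an abelian group. Let $A$ be a $\Gamma$-graded central simple algebra over a $\Gamma$-graded field $R$. Then $A$ is an Azumaya algebra over $R$.
   Context: A $\Gamma$-graded ring is a ring $R = \bigoplus_{\gamma\in\Gamma} R_\gamma$ with additive subgroups $R_\gamma$ satisfying $R_\gamma R_\delta \subseteq R_{\gamma+\delta}$; elements of $\bigcup_\gamma R_\gamma$ are homogeneous. A graded division ring is a graded ring in which every non-zero homogeneous element is invertible; a graded field is a commutative graded division ring. A two-sided ideal $I$ is homogeneous if $I = \bigoplus_\gamma (I \cap R_\gamma)$; a graded ring is graded simple if its only homogeneous two-sided ideals are $0$ and itself. For a commutative $\Gamma$-graded ring $R$, a $\Gamma$-graded $R$-algebra $A$ is a $\Gamma$-graded ring that is an $R$-algebra whose structure map $R \to Z(A)\subseteq A$ is degree-preserving. For a graded field $R$, a graded $R$-algebra $A$ is a graded central simple algebra over $R$ if $A$ is graded simple, $Z(A) \cong R$ as graded rings, and $[A:R] < \infty$ (graded modules over a graded field have a homogeneous basis of well-defined cardinality, the dimension). An algebra $A$ over a commutative ring $R$ is an Azumaya algebra over $R$ if (1) $A$ is faithfully projective (equivalently, finitely generated, projective and faithful) as an $R$-module, and (2) the natural map $A \otimes_R A^{\mathrm{op}} \to \mathrm{End}_R(A)$, $a \otimes b \mapsto (x \mapsto axb)$, is an isomorphism.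
   Formalization: "Z(A) ≅ R as graded rings" is taken to mean that the structure map R → Z(A) itself is an isomorphism of graded rings; with an arbitrary isomorphism the claim fails (R = A = k(t), trivial grading, structure map t ↦ t²). *)

theory Defs
  imports "HOL-Algebra.Algebra" "HOL-Algebra.Free_Abelian_Groups"
begin

section \<open>Algebras, linear maps, bases\<close>

text \<open>The locale \<^locale>\<open>algebra\<close> of the library requires the algebra to be commutative.
  Here an associative unital algebra is a module that is also a ring, with bilinear
  multiplication; its structure map is \<open>r \<mapsto> r \<odot> \<one>\<close>, which automatically is a ring homomorphism
  into the centre.\<close>

locale assoc_algebra = module R A + A?: ring A for R (structure) and A (structure) +
  assumes smult_mult_left:
    "\<lbrakk>r \<in> carrier R; x \<in> carrier A; y \<in> carrier A\<rbrakk>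
      \<Longrightarrow> (r \<odot>\<^bsub>A\<^esub> x) \<otimes>\<^bsub>A\<^esub> y = r \<odot>\<^bsub>A\<^esub> (x \<otimes>\<^bsub>A\<^esub> y)"
  and smult_mult_right:
    "\<lbrakk>r \<in> carrier R; x \<in> carrier A; y \<in> carrier A\<rbrakk>
      \<Longrightarrow> x \<otimes>\<^bsub>A\<^esub> (r \<odot>\<^bsub>A\<^esub> y) = r \<odot>\<^bsub>A\<^esub> (x \<otimes>\<^bsub>A\<^esub> y)"

definition structure_map :: "('r, 'a, 'm) module_scheme \<Rightarrow> 'r \<Rightarrow> 'a"
  where "structure_map A r = r \<odot>\<^bsub>A\<^esub> \<one>\<^bsub>A\<^esub>"

definition ring_center :: "('a, 'm) ring_scheme \<Rightarrow> 'a set"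
  where "ring_center A =
    {z \<in> carrier A. \<forall>a\<in>carrier A. z \<otimes>\<^bsub>A\<^esub> a = a \<otimes>\<^bsub>A\<^esub> z}"

definition center_ring :: "('a, 'm) ring_scheme \<Rightarrow> ('a, 'm) ring_scheme"
  where "center_ring A = A\<lparr>carrier := ring_center A\<rparr>"

definition linear_maps ::
    "('r, 'k) ring_scheme \<Rightarrow> ('r, 'a, 'm) module_scheme \<Rightarrow> ('r, 'b, 'n) module_scheme \<Rightarrow> ('a \<Rightarrow> 'b) set"
  where "linear_maps R M N =
    {f \<in> carrier M \<rightarrow> carrier N.
       (\<forall>x\<in>carrier M. \<forall>y\<in>carrier M. f (x \<oplus>\<^bsub>M\<^esub> y) = f x \<oplus>\<^bsub>N\<^esub> f y) \<and>
       (\<forall>r\<in>carrier R. \<forall>x\<in>carrier M. f (r \<odot>\<^bsub>M\<^esub> x) = r \<odot>\<^bsub>N\<^esub> f x)}"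

definition linear_isos ::
    "('r, 'k) ring_scheme \<Rightarrow> ('r, 'a, 'm) module_scheme \<Rightarrow> ('r, 'b, 'n) module_scheme \<Rightarrow> ('a \<Rightarrow> 'b) set"
  where "linear_isos R M N = {f \<in> linear_maps R M N. bij_betw f (carrier M) (carrier N)}"

definition algebra_isos ::
    "('r, 'k) ring_scheme \<Rightarrow> ('r, 'a, 'm) module_scheme \<Rightarrow> ('r, 'b, 'n) module_scheme \<Rightarrow> ('a \<Rightarrow> 'b) set"
  where "algebra_isos R A B = ring_iso A B \<inter> linear_maps R A B"

definition module_basis ::
    "('r, 'k) ring_scheme \<Rightarrow> ('r, 'a, 'm) module_scheme \<Rightarrow> 'a set \<Rightarrow> bool"
  where "module_basis R M B \<longleftrightarrow>
    B \<subseteq> carrier M \<and>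
    (\<forall>x\<in>carrier M. \<exists>!c. c \<in> B \<rightarrow>\<^sub>E carrier R \<and> finite {b \<in> B. c b \<noteq> \<zero>\<^bsub>R\<^esub>} \<and>
       x = (\<Oplus>\<^bsub>M\<^esub>b\<in>{b \<in> B. c b \<noteq> \<zero>\<^bsub>R\<^esub>}. c b \<odot>\<^bsub>M\<^esub> b))"


section \<open>Graded rings and graded central simple algebras\<close>

text \<open>The additive subgroup \<open>S\<close> of \<open>R\<close> is the internal direct sum of the
  additive subgroups \<open>N j\<close>, \<open>j \<in> J\<close>.\<close>

definition internal_direct_sum ::
    "('a, 'm) ring_scheme \<Rightarrow> 'j set \<Rightarrow> ('j \<Rightarrow> 'a set) \<Rightarrow> 'a set \<Rightarrow> bool"
  where "internal_direct_sum R J N S \<longleftrightarrow>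
    additive_subgroup S R \<and>
    (\<forall>j\<in>J. additive_subgroup (N j) R \<and> N j \<subseteq> S) \<and>
    (\<forall>x\<in>S. \<exists>!c. c \<in> (\<Pi>\<^sub>E j\<in>J. N j) \<and> finite {j \<in> J. c j \<noteq> \<zero>\<^bsub>R\<^esub>} \<and>
       x = (\<Oplus>\<^bsub>R\<^esub>j\<in>{j \<in> J. c j \<noteq> \<zero>\<^bsub>R\<^esub>}. c j))"

text \<open>The grading group is written multiplicatively, as is usual in the library.\<close>

locale graded_ring = Gam: comm_group \<Gamma> + ring R
  for \<Gamma> :: "('g, 'h) monoid_scheme" and R :: "('a, 'm) ring_scheme" (structure) +
  fixes Rg :: "'g \<Rightarrow> 'a set"
  assumes grading_direct_sum: "internal_direct_sum R (carrier \<Gamma>) Rg (carrier R)"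
    and grading_mult:
      "\<lbrakk>\<gamma> \<in> carrier \<Gamma>; \<delta> \<in> carrier \<Gamma>; x \<in> Rg \<gamma>; y \<in> Rg \<delta>\<rbrakk> \<Longrightarrow> x \<otimes> y \<in> Rg (\<gamma> \<otimes>\<^bsub>\<Gamma>\<^esub> \<delta>)"

definition homogeneous_elements :: "('g, 'h) monoid_scheme \<Rightarrow> ('g \<Rightarrow> 'a set) \<Rightarrow> 'a set"
  where "homogeneous_elements \<Gamma> Rg = (\<Union>\<gamma>\<in>carrier \<Gamma>. Rg \<gamma>)"

definition homogeneous_ideal ::
    "('g, 'h) monoid_scheme \<Rightarrow> ('a, 'm) ring_scheme \<Rightarrow> ('g \<Rightarrow> 'a set) \<Rightarrow> 'a set \<Rightarrow> bool"
  where "homogeneous_ideal \<Gamma> R Rg I \<longleftrightarrow>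
    ideal I R \<and> internal_direct_sum R (carrier \<Gamma>) (\<lambda>\<gamma>. I \<inter> Rg \<gamma>) I"

locale graded_simple_ring = graded_ring +
  assumes homogeneous_ideal_trivial:
    "homogeneous_ideal \<Gamma> R Rg I \<Longrightarrow> I = {\<zero>} \<or> I = carrier R"

locale graded_division_ring = graded_ring +
  assumes homogeneous_unit: "\<lbrakk>x \<in> homogeneous_elements \<Gamma> Rg; x \<noteq> \<zero>\<rbrakk> \<Longrightarrow> x \<in> Units R"

locale graded_field = graded_division_ring + cring R

locale graded_algebra =
  R: graded_ring \<Gamma> R Rg + R: cring R + A: graded_ring \<Gamma> A Ag + assoc_algebra R A
  for \<Gamma> :: "('g, 'h) monoid_scheme"
    and R :: "('r, 'k) ring_scheme" (structure) and Rg :: "'g \<Rightarrow> 'r set"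
    and A :: "('r, 'a, 'm) module_scheme" (structure) and Ag :: "'g \<Rightarrow> 'a set" +
  assumes structure_map_degree:
    "\<lbrakk>\<gamma> \<in> carrier \<Gamma>; r \<in> Rg \<gamma>\<rbrakk> \<Longrightarrow> structure_map A r \<in> Ag \<gamma>"

definition graded_ring_isos ::
    "('g, 'h) monoid_scheme \<Rightarrow> ('a, 'm) ring_scheme \<Rightarrow> ('g \<Rightarrow> 'a set) \<Rightarrow>
     ('b, 'n) ring_scheme \<Rightarrow> ('g \<Rightarrow> 'b set) \<Rightarrow> ('a \<Rightarrow> 'b) set"
  where "graded_ring_isos \<Gamma> R Rg S Sg =
    {h \<in> ring_iso R S. \<forall>\<gamma>\<in>carrier \<Gamma>. h ` Rg \<gamma> = Sg \<gamma>}"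

definition finite_graded_dimension ::
    "('g, 'h) monoid_scheme \<Rightarrow> ('r, 'k) ring_scheme \<Rightarrow> ('r, 'a, 'm) module_scheme \<Rightarrow>
     ('g \<Rightarrow> 'a set) \<Rightarrow> bool"
  where "finite_graded_dimension \<Gamma> R M Mg \<longleftrightarrow>
    (\<exists>B. finite B \<and> B \<subseteq> homogeneous_elements \<Gamma> Mg \<and> module_basis R M B)"

text \<open>The identification of \<open>R\<close> with the centre is the one given by the structure map. An
  unrelated ring isomorphism would not do: the field \<open>k(t)\<close>, made a two-dimensional algebra over
  itself by \<open>t \<mapsto> t\<^sup>2\<close>, is simple and equal to its own centre, but it is not an Azumaya algebra.\<close>

locale graded_central_simple_algebra =
  graded_algebra \<Gamma> R Rg A Ag + graded_field \<Gamma> R Rg + A: graded_simple_ring \<Gamma> A Ag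
  for \<Gamma> :: "('g, 'h) monoid_scheme"
    and R :: "('r, 'k) ring_scheme" (structure) and Rg :: "'g \<Rightarrow> 'r set"
    and A :: "('r, 'a, 'm) module_scheme" (structure) and Ag :: "'g \<Rightarrow> 'a set" +
  assumes center_iso:
      "structure_map A \<in>
         graded_ring_isos \<Gamma> R Rg (center_ring A) (\<lambda>\<gamma>. ring_center A \<inter> Ag \<gamma>)"
    and finite_dimension: "finite_graded_dimension \<Gamma> R A Ag"


section \<open>Tensor products and endomorphism algebras\<close>

definition opposite_algebra :: "('r, 'a, 'm) module_scheme \<Rightarrow> ('r, 'a, 'm) module_scheme"
  where "opposite_algebra A = A\<lparr>mult := (\<lambda>a b. b \<otimes>\<^bsub>A\<^esub> a)\<rparr>"

text \<open>The tensor product of two \<open>R\<close>-algebras is the free abelian group on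
  \<open>carrier A \<times> carrier B\<close> modulo the usual bilinearity relations. The free abelian group is
  the integral monoid ring of the product of the multiplicative monoids, and the subgroup
  generated by the relations is a two-sided ideal of that ring.\<close>

definition tensor_free_ring ::
    "('r, 'a, 'm) module_scheme \<Rightarrow> ('r, 'b, 'n) module_scheme \<Rightarrow> ('a \<times> 'b \<Rightarrow>\<^sub>0 int) ring"
  where "tensor_free_ring A B =
    \<lparr>carrier = {f. Poly_Mapping.keys f \<subseteq> carrier A \<times> carrier B},
     monoid.mult = (\<lambda>f g. frag_extend (\<lambda>(a, b).
               frag_extend (\<lambda>(c, d). frag_of (a \<otimes>\<^bsub>A\<^esub> c, b \<otimes>\<^bsub>B\<^esub> d)) g) f),
     one = frag_of (\<one>\<^bsub>A\<^esub>, \<one>\<^bsub>B\<^esub>),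
     ring.zero = 0,
     ring.add = (+)\<rparr>"

definition tensor_relators ::
    "('r, 'k) ring_scheme \<Rightarrow> ('r, 'a, 'm) module_scheme \<Rightarrow> ('r, 'b, 'n) module_scheme \<Rightarrow>
     ('a \<times> 'b \<Rightarrow>\<^sub>0 int) set"
  where "tensor_relators R A B =
    {frag_of (a \<oplus>\<^bsub>A\<^esub> a', b) - frag_of (a, b) - frag_of (a', b) | a a' b.
       a \<in> carrier A \<and> a' \<in> carrier A \<and> b \<in> carrier B} \<union>
    {frag_of (a, b \<oplus>\<^bsub>B\<^esub> b') - frag_of (a, b) - frag_of (a, b') | a b b'.
       a \<in> carrier A \<and> b \<in> carrier B \<and> b' \<in> carrier B} \<union>
    {frag_of (r \<odot>\<^bsub>A\<^esub> a, b) - frag_of (a, r \<odot>\<^bsub>B\<^esub> b) | r a b.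
       r \<in> carrier R \<and> a \<in> carrier A \<and> b \<in> carrier B}"

definition tensor_kernel ::
    "('r, 'k) ring_scheme \<Rightarrow> ('r, 'a, 'm) module_scheme \<Rightarrow> ('r, 'b, 'n) module_scheme \<Rightarrow>
     ('a \<times> 'b \<Rightarrow>\<^sub>0 int) set"
  where "tensor_kernel R A B =
    generate (add_monoid (tensor_free_ring A B)) (tensor_relators R A B)"

definition pure_tensor ::
    "('r, 'k) ring_scheme \<Rightarrow> ('r, 'a, 'm) module_scheme \<Rightarrow> ('r, 'b, 'n) module_scheme \<Rightarrow>
     'a \<Rightarrow> 'b \<Rightarrow> ('a \<times> 'b \<Rightarrow>\<^sub>0 int) set"
  where "pure_tensor R A B a b =
    tensor_kernel R A B +>\<^bsub>tensor_free_ring A B\<^esub> frag_of (a, b)"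

text \<open>Scalars act by \<open>r (a \<otimes> b) = (r a) \<otimes> b\<close>.\<close>

definition tensor_algebra ::
    "('r, 'k) ring_scheme \<Rightarrow> ('r, 'a, 'm) module_scheme \<Rightarrow> ('r, 'b, 'n) module_scheme \<Rightarrow>
     ('r, ('a \<times> 'b \<Rightarrow>\<^sub>0 int) set) module"
  where "tensor_algebra R A B =
    (let F = tensor_free_ring A B; N = tensor_kernel R A B; Q = F Quot N in
     \<lparr>carrier = carrier Q, monoid.mult = monoid.mult Q, one = one Q, ring.zero = ring.zero Q, ring.add = ring.add Q,
      smult = (\<lambda>r C. \<Union>f\<in>C. N +>\<^bsub>F\<^esub> frag_extend (\<lambda>(a, b). frag_of (r \<odot>\<^bsub>A\<^esub> a, b)) f)\<rparr>)"

definition endomorphism_algebra ::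
    "('r, 'k) ring_scheme \<Rightarrow> ('r, 'a, 'm) module_scheme \<Rightarrow> ('r, 'a \<Rightarrow> 'a) module"
  where "endomorphism_algebra R M =
    \<lparr>carrier = linear_maps R M M \<inter> extensional (carrier M),
     monoid.mult = compose (carrier M),
     one = (\<lambda>x\<in>carrier M. x),
     ring.zero = (\<lambda>x\<in>carrier M. \<zero>\<^bsub>M\<^esub>),
     ring.add = (\<lambda>f g. \<lambda>x\<in>carrier M. f x \<oplus>\<^bsub>M\<^esub> g x),
     smult = (\<lambda>r f. \<lambda>x\<in>carrier M. r \<odot>\<^bsub>M\<^esub> f x)\<rparr>"


section \<open>Azumaya algebras\<close>

definition finitely_generated_module ::
    "('r, 'k) ring_scheme \<Rightarrow> ('r, 'a, 'm) module_scheme \<Rightarrow> bool"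
  where "finitely_generated_module R M \<longleftrightarrow>
    (\<exists>S. finite S \<and> S \<subseteq> carrier M \<and>
       (\<forall>x\<in>carrier M. \<exists>c\<in>S \<rightarrow> carrier R. x = (\<Oplus>\<^bsub>M\<^esub>s\<in>S. c s \<odot>\<^bsub>M\<^esub> s)))"

definition faithful_module ::
    "('r, 'k) ring_scheme \<Rightarrow> ('r, 'a, 'm) module_scheme \<Rightarrow> bool"
  where "faithful_module R M \<longleftrightarrow>
    (\<forall>r\<in>carrier R. (\<forall>x\<in>carrier M. r \<odot>\<^bsub>M\<^esub> x = \<zero>\<^bsub>M\<^esub>) \<longrightarrow> r = \<zero>\<^bsub>R\<^esub>)"

text \<open>The free module on \<open>I\<close>: finitely supported functions from \<open>I\<close> to \<open>R\<close>. The ring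
  operations of the record are irrelevant, so its multiplication and unit are left undefined.\<close>

definition free_module :: "('r, 'k) ring_scheme \<Rightarrow> 'i set \<Rightarrow> ('r, 'i \<Rightarrow> 'r) module"
  where "free_module R I =
    \<lparr>carrier = {f \<in> I \<rightarrow>\<^sub>E carrier R. finite {i \<in> I. f i \<noteq> \<zero>\<^bsub>R\<^esub>}},
     monoid.mult = undefined, one = undefined,
     ring.zero = (\<lambda>i\<in>I. \<zero>\<^bsub>R\<^esub>),
     ring.add = (\<lambda>f g. \<lambda>i\<in>I. f i \<oplus>\<^bsub>R\<^esub> g i),
     smult = (\<lambda>r f. \<lambda>i\<in>I. r \<otimes>\<^bsub>R\<^esub> f i)\<rparr>"

text \<open>Projective: isomorphic to a direct summand of a free module. It is no restriction to take
  the index set \<open>I\<close> in the type of the elements of \<open>M\<close>: a projective \<open>M\<close> is a direct summand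
  of the free module on \<open>carrier M\<close>.\<close>

definition projective_module ::
    "('r, 'k) ring_scheme \<Rightarrow> ('r, 'a, 'm) module_scheme \<Rightarrow> bool"
  where "projective_module R M \<longleftrightarrow>
    (\<exists>(I :: 'a set) N N' h.
       submodule N R (free_module R I) \<and> submodule N' R (free_module R I) \<and>
       N \<inter> N' = {\<zero>\<^bsub>free_module R I\<^esub>} \<and>
       N <+>\<^bsub>free_module R I\<^esub> N' = carrier (free_module R I) \<and>
       h \<in> linear_isos R M ((free_module R I)\<lparr>carrier := N\<rparr>))"

definition faithfully_projective ::
    "('r, 'k) ring_scheme \<Rightarrow> ('r, 'a, 'm) module_scheme \<Rightarrow> bool"
  where "faithfully_projective R M \<longleftrightarrow>
    finitely_generated_module R M \<and> projective_module R M \<and> faithful_module R M"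

text \<open>Pure tensors generate the tensor product additively, so the homomorphism \<open>\<Phi>\<close> below is
  determined on its whole domain: it is the natural map.\<close>

definition azumaya_algebra ::
    "('r, 'k) ring_scheme \<Rightarrow> ('r, 'a, 'm) module_scheme \<Rightarrow> bool"
  where "azumaya_algebra R A \<longleftrightarrow>
    assoc_algebra R A \<and> faithfully_projective R A \<and>
    (\<exists>\<Phi> \<in> algebra_isos R (tensor_algebra R A (opposite_algebra A)) (endomorphism_algebra R A).
       \<forall>a\<in>carrier A. \<forall>b\<in>carrier A.
         \<Phi> (pure_tensor R A (opposite_algebra A) a b) =
           (\<lambda>x\<in>carrier A. a \<otimes>\<^bsub>A\<^esub> x \<otimes>\<^bsub>A\<^esub> b))"

end

theory Submission
  imports Defs
begin

text \<open>Let \<open>B\<close> be a finite homogeneous basis of \<open>A\<close> and let \<open>M\<close> be the additive span of the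
  operators \<open>x \<mapsto> a x c\<close>. A graded version of the density theorem provides operators \<open>T\<^sub>b \<in> M\<close> with
  \<open>T\<^sub>b b' = \<delta>\<^sub>b\<^sub>b\<^sub>'\<close>. By induction it suffices to treat one \<open>b \<in> S \<subseteq> B\<close>, with such operators \<open>T\<^sub>s\<close>
  given for \<open>S - {b}\<close>: the values at \<open>b\<close> of the operators that kill \<open>S - {b}\<close> form a homogeneous
  ideal. If it is \<open>0\<close>, the commutators \<open>a T\<^sub>s - T\<^sub>s a\<close> show that every \<open>T\<^sub>s b\<close> is a scalar, and then
  \<open>id - (\<Sum>\<^sub>s s T\<^sub>s)\<close> shows that \<open>b\<close> is a linear combination of \<open>S - {b}\<close>. So the ideal contains \<open>1\<close>.

  Every endomorphism \<open>f\<close> equals \<open>\<Sum>\<^sub>b f(b) T\<^sub>b\<close>, hence lies in \<open>M\<close>. Conversely, if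
  \<open>\<Sum>\<^sub>b a\<^sub>b \<otimes> b\<close> maps to \<open>0\<close>, then \<open>\<Sum>\<^sub>b a\<^sub>b x T(b) = 0\<close> for all \<open>T \<in> M\<close>, and \<open>T = T\<^sub>b\<close>, \<open>x = 1\<close> give
  \<open>a\<^sub>b = 0\<close>; so no dimension count is needed.\<close>

section \<open>Modules with a finite basis\<close>

context module
begin

text \<open>Terms with coefficient 0 contribute 0, so over a finite basis the sum over the support
  in \<open>module_basis\<close> equals the sum over all of \<open>B\<close>. Coordinates can then
  be handled without tracking supports.\<close>

lemma finite_basis_ex1:
  assumes B: "module_basis R M B" "finite B" and x: "x \<in> carrier M"
  shows "\<exists>!c. c \<in> B \<rightarrow>\<^sub>E carrier R \<and> x = (\<Oplus>\<^bsub>M\<^esub>b\<in>B. c b \<odot>\<^bsub>M\<^esub> b)"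
proof -
  have sub: "B \<subseteq> carrier M"
    using B by (simp add: module_basis_def)
  have eq: "(\<Oplus>\<^bsub>M\<^esub>b\<in>{b \<in> B. c b \<noteq> \<zero>\<^bsub>R\<^esub>}. c b \<odot>\<^bsub>M\<^esub> b) = (\<Oplus>\<^bsub>M\<^esub>b\<in>B. c b \<odot>\<^bsub>M\<^esub> b)"
    if "c \<in> B \<rightarrow>\<^sub>E carrier R" for c
    by (rule M.add.finprod_mono_neutral_cong_left) (use that sub B in \<open>auto simp: PiE_iff\<close>)
  have fin: "finite {b \<in> B. c b \<noteq> \<zero>\<^bsub>R\<^esub>}" for c
    using B by simp
  have "\<exists>!c. c \<in> B \<rightarrow>\<^sub>E carrier R \<and> finite {b \<in> B. c b \<noteq> \<zero>\<^bsub>R\<^esub>} \<and>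
       x = (\<Oplus>\<^bsub>M\<^esub>b\<in>{b \<in> B. c b \<noteq> \<zero>\<^bsub>R\<^esub>}. c b \<odot>\<^bsub>M\<^esub> b)"
    using B x unfolding module_basis_def by blast
  then show ?thesis
    by (simp add: fin eq cong: conj_cong)
qed

definition coords :: "'c set \<Rightarrow> 'c \<Rightarrow> 'c \<Rightarrow> 'a"
  where "coords B x = (THE c. c \<in> B \<rightarrow>\<^sub>E carrier R \<and> x = (\<Oplus>\<^bsub>M\<^esub>b\<in>B. c b \<odot>\<^bsub>M\<^esub> b))"

lemma module_free_module:
  fixes I :: "'i set"
  assumes "finite I"
  shows "module R (free_module R I)"
proof (rule moduleI)
  show "abelian_group (free_module R I)"
  proof (rule abelian_groupI)
    fix f assume "f \<in> carrier (free_module R I)"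
    then show "\<exists>g\<in>carrier (free_module R I). g \<oplus>\<^bsub>free_module R I\<^esub> f = \<zero>\<^bsub>free_module R I\<^esub>"
      using assms by (intro bexI[of _ "\<lambda>i\<in>I. \<ominus> f i"]) (auto simp: free_module_def R.l_neg PiE_iff)
  qed (use assms in \<open>auto simp: free_module_def R.a_ac fun_eq_iff PiE_iff extensional_def\<close>)
qed (use assms in \<open>auto simp: free_module_def R.l_distr R.r_distr R.m_assoc fun_eq_iff PiE_iff
      extensional_def intro: R.is_cring\<close>)

context
  fixes B
  assumes basis: "module_basis R M B" and finite_basis: "finite B"
begin

lemma basis_closed: "B \<subseteq> carrier M"
  using basis by (simp add: module_basis_def)

lemma coords:
  assumes "x \<in> carrier M"
  shows "coords B x \<in> B \<rightarrow>\<^sub>E carrier R" "(\<Oplus>\<^bsub>M\<^esub>b\<in>B. coords B x b \<odot>\<^bsub>M\<^esub> b) = x"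
  using theI'[OF finite_basis_ex1[OF basis finite_basis assms]] unfolding coords_def by auto

lemma coords_unique:
  assumes "c \<in> B \<rightarrow>\<^sub>E carrier R"
  shows "coords B (\<Oplus>\<^bsub>M\<^esub>b\<in>B. c b \<odot>\<^bsub>M\<^esub> b) = c"
proof -
  have "(\<Oplus>\<^bsub>M\<^esub>b\<in>B. c b \<odot>\<^bsub>M\<^esub> b) \<in> carrier M"
    using assms basis_closed by (auto intro!: M.finsum_closed)
  from finite_basis_ex1[OF basis finite_basis this] show ?thesis
    unfolding coords_def using assms by (intro the1_equality) auto
qed

lemma coords_add:
  assumes "x \<in> carrier M" "y \<in> carrier M"
  shows "coords B (x \<oplus>\<^bsub>M\<^esub> y) = (\<lambda>b\<in>B. coords B x b \<oplus> coords B y b)"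
proof -
  note c = coords[OF assms(1)] and d = coords[OF assms(2)]
  have "x \<oplus>\<^bsub>M\<^esub> y = (\<Oplus>\<^bsub>M\<^esub>b\<in>B. coords B x b \<odot>\<^bsub>M\<^esub> b \<oplus>\<^bsub>M\<^esub> coords B y b \<odot>\<^bsub>M\<^esub> b)"
    using c d basis_closed by (subst M.finsum_addf) (auto simp: PiE_iff)
  also have "\<dots> = (\<Oplus>\<^bsub>M\<^esub>b\<in>B. (\<lambda>b\<in>B. coords B x b \<oplus> coords B y b) b \<odot>\<^bsub>M\<^esub> b)"
    using c d basis_closed by (intro M.finsum_cong') (auto simp: PiE_iff smult_l_distr subset_iff)
  finally show ?thesis
    using coords_unique[of "\<lambda>b\<in>B. coords B x b \<oplus> coords B y b"] c d by (auto simp: PiE_iff)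
qed

lemma coords_smult:
  assumes "r \<in> carrier R" "x \<in> carrier M"
  shows "coords B (r \<odot>\<^bsub>M\<^esub> x) = (\<lambda>b\<in>B. r \<otimes> coords B x b)"
proof -
  note c = coords[OF assms(2)]
  have "r \<odot>\<^bsub>M\<^esub> x = (\<Oplus>\<^bsub>M\<^esub>b\<in>B. r \<odot>\<^bsub>M\<^esub> (coords B x b \<odot>\<^bsub>M\<^esub> b))"
    using c basis_closed assms finite_basis
    by (subst finsum_smult_ldistr[symmetric]) (auto simp: PiE_iff)
  also have "\<dots> = (\<Oplus>\<^bsub>M\<^esub>b\<in>B. (\<lambda>b\<in>B. r \<otimes> coords B x b) b \<odot>\<^bsub>M\<^esub> b)"
    using c basis_closed assms by (intro M.finsum_cong') (auto simp: PiE_iff smult_assoc1 subset_iff)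
  finally show ?thesis
    using coords_unique[of "\<lambda>b\<in>B. r \<otimes> coords B x b"] c assms by (auto simp: PiE_iff)
qed

lemma finitely_generated_of_basis: "finitely_generated_module R M"
  unfolding finitely_generated_module_def
proof (intro exI[of _ B] conjI ballI)
  fix x assume "x \<in> carrier M"
  then show "\<exists>c\<in>B \<rightarrow> carrier R. x = (\<Oplus>\<^bsub>M\<^esub>b\<in>B. c b \<odot>\<^bsub>M\<^esub> b)"
    using coords[of x] by (auto simp: PiE_def intro!: bexI[of _ "coords B x"])
qed (use finite_basis basis_closed in auto)

text \<open>The coordinate map identifies the module with the free module on \<open>B\<close>, which
  is a summand of itself with complement 0.\<close>

lemma projective_of_basis: "projective_module R M"
proof -
  let ?F = "free_module R B"
  interpret F: module R ?F
    by (rule module_free_module[OF finite_basis])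
  have carr: "carrier ?F = (B \<rightarrow>\<^sub>E carrier R)"
    using finite_basis by (simp add: free_module_def)
  have "submodule {\<zero>\<^bsub>?F\<^esub>} R ?F"
    by (rule F.submoduleI) auto
  moreover have "carrier ?F <+>\<^bsub>?F\<^esub> {\<zero>\<^bsub>?F\<^esub>} = carrier ?F"
    by (auto simp: set_add_def' F.M.r_zero)
  moreover have "coords B \<in> linear_isos R M (?F\<lparr>carrier := carrier ?F\<rparr>)"
    unfolding linear_isos_def linear_maps_def
  proof (intro CollectI conjI ballI)
    show "coords B \<in> carrier M \<rightarrow> carrier (?F\<lparr>carrier := carrier ?F\<rparr>)"
      using coords carr by auto
    show "bij_betw (coords B) (carrier M) (carrier (?F\<lparr>carrier := carrier ?F\<rparr>))"
      by (rule bij_betwI[of _ _ _ "\<lambda>c. \<Oplus>\<^bsub>M\<^esub>b\<in>B. c b \<odot>\<^bsub>M\<^esub> b"])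
        (use coords coords_unique basis_closed in \<open>auto simp: carr PiE_iff intro!: M.finsum_closed\<close>)
  qed (auto simp: coords_add coords_smult free_module_def)
  ultimately show ?thesis
    unfolding projective_module_def using F.carrier_is_submodule by blast
qed

end

section \<open>Linear maps and the endomorphism ring\<close>

lemma linear_map_finsum:
  assumes "abelian_group N" "f \<in> linear_maps R M N" "finite I" "g \<in> I \<rightarrow> carrier M"
  shows "f (\<Oplus>\<^bsub>M\<^esub>i\<in>I. g i) = (\<Oplus>\<^bsub>N\<^esub>i\<in>I. f (g i))"
proof -
  interpret N: abelian_group N by fact
  have f: "\<And>x. x \<in> carrier M \<Longrightarrow> f x \<in> carrier N"
      "\<And>x y. x \<in> carrier M \<Longrightarrow> y \<in> carrier M \<Longrightarrow> f (x \<oplus>\<^bsub>M\<^esub> y) = f x \<oplus>\<^bsub>N\<^esub> f y"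
    using assms(2) by (auto simp: linear_maps_def)
  have "f \<zero>\<^bsub>M\<^esub> \<oplus>\<^bsub>N\<^esub> f \<zero>\<^bsub>M\<^esub> = f \<zero>\<^bsub>M\<^esub>"
    using f(2)[of "\<zero>\<^bsub>M\<^esub>" "\<zero>\<^bsub>M\<^esub>"] by simp
  then have "f \<zero>\<^bsub>M\<^esub> = \<zero>\<^bsub>N\<^esub>"
    using f(1) by simp
  with assms(3,4) show ?thesis
    by (induction I rule: finite_induct) (auto simp: f Pi_iff)
qed

lemma linear_map_coords:
  assumes "module_basis R M B" "finite B" "abelian_group N" "f \<in> linear_maps R M N" "x \<in> carrier M"
  shows "f x = (\<Oplus>\<^bsub>N\<^esub>b\<in>B. coords B x b \<odot>\<^bsub>N\<^esub> f b)"
proof -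
  interpret N: abelian_group N by fact
  note c = coords[OF assms(1,2,5)] and B = basis_closed[OF assms(1,2)]
  have "f (\<Oplus>\<^bsub>M\<^esub>b\<in>B. coords B x b \<odot>\<^bsub>M\<^esub> b) = (\<Oplus>\<^bsub>N\<^esub>b\<in>B. f (coords B x b \<odot>\<^bsub>M\<^esub> b))"
    using c(1) B by (intro linear_map_finsum assms) (auto simp: PiE_iff)
  also have "\<dots> = (\<Oplus>\<^bsub>N\<^esub>b\<in>B. coords B x b \<odot>\<^bsub>N\<^esub> f b)"
  proof (rule N.finsum_cong'[OF refl])
    have *: "coords B x b \<in> carrier R" "b \<in> carrier M" if "b \<in> B" for b
      using that c(1) B by auto
    then have eq: "f (coords B x b \<odot>\<^bsub>M\<^esub> b) = coords B x b \<odot>\<^bsub>N\<^esub> f b" if "b \<in> B" for b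
      using that assms(4) by (auto simp: linear_maps_def)
    then show "\<And>b. b \<in> B \<Longrightarrow> f (coords B x b \<odot>\<^bsub>M\<^esub> b) = coords B x b \<odot>\<^bsub>N\<^esub> f b" .
    \<comment> \<open>\<open>N\<close> is assumed to be an abelian group only, so closure of the
      scalar multiples does not come from module laws: each multiple is rewritten as the value of
      \<open>f\<close> at a multiple of \<open>b\<close>.\<close>
    have "f \<in> carrier M \<rightarrow> carrier N"
      using assms(4) by (simp add: linear_maps_def)
    then show "(\<lambda>b. coords B x b \<odot>\<^bsub>N\<^esub> f b) \<in> B \<rightarrow> carrier N"
      using * by (auto simp flip: eq)
  qed
  finally show ?thesis
    by (simp add: c(2))
qed

lemma ring_endomorphism_algebra: "ring (endomorphism_algebra R M)"
proof (rule ringI)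
  show "abelian_group (endomorphism_algebra R M)"
  proof (rule abelian_groupI)
    fix f assume f: "f \<in> carrier (endomorphism_algebra R M)"
    then have "(\<lambda>x\<in>carrier M. \<ominus>\<^bsub>M\<^esub> f x) \<in> carrier (endomorphism_algebra R M)"
      by (auto simp: endomorphism_algebra_def linear_maps_def M.minus_add M.a_comm Pi_iff smult_r_minus)
    with f show "\<exists>g\<in>carrier (endomorphism_algebra R M).
        g \<oplus>\<^bsub>endomorphism_algebra R M\<^esub> f = \<zero>\<^bsub>endomorphism_algebra R M\<^esub>"
      by (intro bexI[of _ "\<lambda>x\<in>carrier M. \<ominus>\<^bsub>M\<^esub> f x"])
        (auto simp: endomorphism_algebra_def M.l_neg linear_maps_def Pi_iff)
  qed (auto simp: endomorphism_algebra_def linear_maps_def Pi_iff M.a_ac smult_r_distr fun_eq_iff extensional_def)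
  show "monoid (endomorphism_algebra R M)"
    by (rule monoidI)
      (auto simp: endomorphism_algebra_def linear_maps_def Pi_iff fun_eq_iff extensional_def compose_def)
qed (auto simp: endomorphism_algebra_def linear_maps_def Pi_iff fun_eq_iff extensional_def compose_def)

end

section \<open>The ring underlying the tensor product\<close>

lemma add_monoid_tensor_free_ring:
  "add_monoid (tensor_free_ring A B) = free_Abelian_group (carrier A \<times> carrier B)"
  by (simp add: tensor_free_ring_def free_Abelian_group_def)

lemma tensor_free_ring_simps:
  "f \<in> carrier (tensor_free_ring A B) \<longleftrightarrow> Poly_Mapping.keys f \<subseteq> carrier A \<times> carrier B"
  "f \<oplus>\<^bsub>tensor_free_ring A B\<^esub> g = f + g"
  "\<zero>\<^bsub>tensor_free_ring A B\<^esub> = 0"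
  "\<one>\<^bsub>tensor_free_ring A B\<^esub> = frag_of (\<one>\<^bsub>A\<^esub>, \<one>\<^bsub>B\<^esub>)"
  by (simp_all add: tensor_free_ring_def)

lemma tensor_free_ring_mult_of:
  "frag_of (a, b) \<otimes>\<^bsub>tensor_free_ring A B\<^esub> frag_of (c, d) = frag_of (a \<otimes>\<^bsub>A\<^esub> c, b \<otimes>\<^bsub>B\<^esub> d)"
  by (simp add: tensor_free_ring_def)

lemma tensor_free_ring_mult_left:
  "0 \<otimes>\<^bsub>tensor_free_ring A B\<^esub> g = 0"
  "(f + f') \<otimes>\<^bsub>tensor_free_ring A B\<^esub> g =
    f \<otimes>\<^bsub>tensor_free_ring A B\<^esub> g + f' \<otimes>\<^bsub>tensor_free_ring A B\<^esub> g"
  "(f - f') \<otimes>\<^bsub>tensor_free_ring A B\<^esub> g =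
    f \<otimes>\<^bsub>tensor_free_ring A B\<^esub> g - f' \<otimes>\<^bsub>tensor_free_ring A B\<^esub> g"
  by (simp_all add: tensor_free_ring_def frag_extend_add frag_extend_diff)

text \<open>The product is a linear extension in the left factor first, so additivity in the right
  factor takes an induction on \<open>f\<close>. The induction rule asks for a set containing the
  support, and \<open>UNIV\<close> imposes no restriction.\<close>

lemma tensor_free_ring_mult_right:
  "f \<otimes>\<^bsub>tensor_free_ring A B\<^esub> 0 = 0"
  "f \<otimes>\<^bsub>tensor_free_ring A B\<^esub> (g + g') =
    f \<otimes>\<^bsub>tensor_free_ring A B\<^esub> g + f \<otimes>\<^bsub>tensor_free_ring A B\<^esub> g'"
  "f \<otimes>\<^bsub>tensor_free_ring A B\<^esub> (g - g') =
    f \<otimes>\<^bsub>tensor_free_ring A B\<^esub> g - f \<otimes>\<^bsub>tensor_free_ring A B\<^esub> g'"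
proof -
  have "f \<otimes>\<^bsub>tensor_free_ring A B\<^esub> 0 = 0 \<and>
      f \<otimes>\<^bsub>tensor_free_ring A B\<^esub> (g + g') =
      f \<otimes>\<^bsub>tensor_free_ring A B\<^esub> g + f \<otimes>\<^bsub>tensor_free_ring A B\<^esub> g' \<and>
      f \<otimes>\<^bsub>tensor_free_ring A B\<^esub> (g - g') =
      f \<otimes>\<^bsub>tensor_free_ring A B\<^esub> g - f \<otimes>\<^bsub>tensor_free_ring A B\<^esub> g'"
    using subset_UNIV[of "Poly_Mapping.keys f"]
  proof (induction f rule: frag_induction)
    case (one x)
    show ?case
      by (cases x) (simp add: tensor_free_ring_def frag_extend_add frag_extend_diff)
  qed (simp_all add: tensor_free_ring_mult_left)
  then show "f \<otimes>\<^bsub>tensor_free_ring A B\<^esub> 0 = 0"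
    "f \<otimes>\<^bsub>tensor_free_ring A B\<^esub> (g + g') =
      f \<otimes>\<^bsub>tensor_free_ring A B\<^esub> g + f \<otimes>\<^bsub>tensor_free_ring A B\<^esub> g'"
    "f \<otimes>\<^bsub>tensor_free_ring A B\<^esub> (g - g') =
      f \<otimes>\<^bsub>tensor_free_ring A B\<^esub> g - f \<otimes>\<^bsub>tensor_free_ring A B\<^esub> g'"
    by auto
qed

text \<open>Multiplication is biadditive, so closure, associativity and the unit laws reduce by
  induction to generators \<open>frag_of (a, b)\<close>, where they are the laws of the product
  monoid.\<close>

lemma ring_tensor_free_ring:
  assumes "monoid A" "monoid B"
  shows "ring (tensor_free_ring A B)"
proof -
  interpret A: monoid A by fact
  interpret B: monoid B by fact
  let ?F = "tensor_free_ring A B"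
  let ?S = "carrier A \<times> carrier B"
  have closed: "f \<otimes>\<^bsub>?F\<^esub> g \<in> carrier ?F" if "Poly_Mapping.keys f \<subseteq> ?S" "Poly_Mapping.keys g \<subseteq> ?S" for f g
    using that
  proof (induction f rule: frag_induction)
    case (one x)
    show ?case
      using one(2)
    proof (induction g rule: frag_induction)
      case (one y)
      with \<open>x \<in> ?S\<close> show ?case
        by (cases x; cases y) (auto simp: tensor_free_ring_mult_of tensor_free_ring_simps)
    qed (auto simp: tensor_free_ring_mult_right tensor_free_ring_simps dest: set_mp[OF keys_diff])
  qed (auto simp: tensor_free_ring_mult_left tensor_free_ring_simps dest: set_mp[OF keys_diff])
  have assoc: "(f \<otimes>\<^bsub>?F\<^esub> g) \<otimes>\<^bsub>?F\<^esub> h = f \<otimes>\<^bsub>?F\<^esub> (g \<otimes>\<^bsub>?F\<^esub> h)"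
    if "Poly_Mapping.keys f \<subseteq> ?S" "Poly_Mapping.keys g \<subseteq> ?S" "Poly_Mapping.keys h \<subseteq> ?S" for f g h
    using that(1)
  proof (induction f rule: frag_induction)
    case (one x)
    show ?case
      using that(2)
    proof (induction g rule: frag_induction)
      case (one y)
      show ?case
        using that(3)
      proof (induction h rule: frag_induction)
        case (one z)
        with \<open>x \<in> ?S\<close> \<open>y \<in> ?S\<close> show ?case
          by (cases x; cases y; cases z) (auto simp: tensor_free_ring_mult_of A.m_assoc B.m_assoc)
      qed (simp_all add: tensor_free_ring_mult_right)
    qed (simp_all add: tensor_free_ring_mult_right tensor_free_ring_mult_left)
  qed (simp_all add: tensor_free_ring_mult_left)
  have one_left: "\<one>\<^bsub>?F\<^esub> \<otimes>\<^bsub>?F\<^esub> f = f" if "Poly_Mapping.keys f \<subseteq> ?S" for f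
    using that
    by (induction f rule: frag_induction)
      (auto simp: tensor_free_ring_mult_right tensor_free_ring_mult_of tensor_free_ring_simps(4))
  have one_right: "f \<otimes>\<^bsub>?F\<^esub> \<one>\<^bsub>?F\<^esub> = f" if "Poly_Mapping.keys f \<subseteq> ?S" for f
    using that
    by (induction f rule: frag_induction)
      (auto simp: tensor_free_ring_mult_left tensor_free_ring_mult_of tensor_free_ring_simps(4))
  show ?thesis
  proof (rule ringI)
    have "comm_group (add_monoid ?F)"
      by (simp only: add_monoid_tensor_free_ring abelian_free_Abelian_group)
    then show "abelian_group ?F"
      by (intro abelian_group.intro abelian_monoid.intro abelian_group_axioms.intro comm_group.axioms)
    show "monoid ?F"
      by (rule monoidI) (use closed assoc one_left one_right in \<open>auto simp: tensor_free_ring_simps\<close>)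
  qed (simp_all add: tensor_free_ring_simps tensor_free_ring_mult_left tensor_free_ring_mult_right)
qed

lemma opposite_algebra_simps [simp]:
  "carrier (opposite_algebra A) = carrier A"
  "a \<otimes>\<^bsub>opposite_algebra A\<^esub> b = b \<otimes>\<^bsub>A\<^esub> a"
  "\<one>\<^bsub>opposite_algebra A\<^esub> = \<one>\<^bsub>A\<^esub>"
  "a \<oplus>\<^bsub>opposite_algebra A\<^esub> b = a \<oplus>\<^bsub>A\<^esub> b"
  "\<zero>\<^bsub>opposite_algebra A\<^esub> = \<zero>\<^bsub>A\<^esub>"
  "r \<odot>\<^bsub>opposite_algebra A\<^esub> b = r \<odot>\<^bsub>A\<^esub> b"
  by (simp_all add: opposite_algebra_def)

lemma monoid_opposite_algebra:
  assumes "monoid A"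
  shows "monoid (opposite_algebra A)"
proof -
  interpret monoid A by fact
  show ?thesis
    by (rule monoidI) (auto simp: m_assoc)
qed

section \<open>The natural map on the free ring\<close>

context assoc_algebra
begin

abbreviation env :: "('c \<times> 'c \<Rightarrow>\<^sub>0 int) ring"
  where "env \<equiv> tensor_free_ring A (opposite_algebra A)"

abbreviation two_sided :: "'c \<Rightarrow> 'c \<Rightarrow> 'c \<Rightarrow> 'c"
  where "two_sided a b \<equiv> \<lambda>x\<in>carrier A. a \<otimes>\<^bsub>A\<^esub> x \<otimes>\<^bsub>A\<^esub> b"

lemma ring_env: "ring env"
  by (intro ring_tensor_free_ring monoid_opposite_algebra A.monoid_axioms)

lemma two_sided_endomorphism:
  assumes "a \<in> carrier A" "b \<in> carrier A"
  shows "two_sided a b \<in> carrier (endomorphism_algebra R A)"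
  using assms
  by (auto simp: endomorphism_algebra_def linear_maps_def A.l_distr A.r_distr
      smult_mult_left smult_mult_right)

text \<open>The universal property of the free abelian group supplies an additive \<open>h\<close>.
  Multiplicativity is checked on generators: x \<mapsto> c x d followed by x \<mapsto> a x b is x
  \<mapsto> a c x d b, and d b is the product of b and d in the opposite algebra.\<close>

lemma two_sided_hom:
  obtains h where "h \<in> ring_hom env (endomorphism_algebra R A)"
    and "\<And>a b. a \<in> carrier A \<Longrightarrow> b \<in> carrier A \<Longrightarrow> h (frag_of (a, b)) = two_sided a b"
proof -
  let ?E = "endomorphism_algebra R A" and ?S = "carrier A \<times> carrier A"
  interpret E: ring ?E by (rule ring_endomorphism_algebra)
  interpret F: ring env by (rule ring_env)
  have "(\<lambda>(a, b). two_sided a b) ` ?S \<subseteq> carrier (add_monoid ?E)"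
    using two_sided_endomorphism by auto
  from comm_group.free_Abelian_group_universal[OF E.a_comm_group this]
  obtain h where h: "h \<in> hom (free_Abelian_group ?S) (add_monoid ?E)"
    and h_of: "\<And>z. z \<in> ?S \<Longrightarrow> h (frag_of z) = (\<lambda>(a, b). two_sided a b) z"
    by blast
  have hom: "h \<in> hom (add_monoid env) (add_monoid ?E)"
    using h by (simp only: add_monoid_tensor_free_ring opposite_algebra_simps)
  interpret h: abelian_group_hom env ?E h
    by (intro abelian_group_homI group_hom.intro group_hom_axioms.intro hom F.a_group E.a_group
        F.abelian_group_axioms E.abelian_group_axioms)
  have carr: "f \<in> carrier env \<longleftrightarrow> Poly_Mapping.keys f \<subseteq> ?S" for f
    by (simp add: tensor_free_ring_simps)
  \<comment> \<open>\<open>h\<close> is known to be additive, whereas the inductions below proceed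
    by differences; the passage is to write \<open>f\<close> as \<open>(f - g) + g\<close>.\<close>
  have h_diff: "h (f - g) = h f \<ominus>\<^bsub>?E\<^esub> h g" if "Poly_Mapping.keys f \<subseteq> ?S" "Poly_Mapping.keys g \<subseteq> ?S" for f g
  proof -
    have "Poly_Mapping.keys (f - g) \<subseteq> ?S"
      using that keys_diff[of f g] by auto
    then have "f - g \<in> carrier env" "f \<in> carrier env" "g \<in> carrier env"
      using that by (simp_all add: carr)
    moreover from this have "h ((f - g) \<oplus>\<^bsub>env\<^esub> g) = h (f - g) \<oplus>\<^bsub>?E\<^esub> h g"
      by simp
    ultimately show ?thesis
      by (simp add: tensor_free_ring_simps(2) E.minus_eq E.add.m_assoc E.r_neg)
  qed
  have h_zero: "h 0 = \<zero>\<^bsub>?E\<^esub>"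
    using h.hom_zero by (simp add: tensor_free_ring_simps)
  have mult: "h (f \<otimes>\<^bsub>env\<^esub> g) = h f \<otimes>\<^bsub>?E\<^esub> h g"
    if "Poly_Mapping.keys f \<subseteq> ?S" "Poly_Mapping.keys g \<subseteq> ?S" for f g
    using that(1)
  proof (induction f rule: free_Abelian_group_induct[consumes 1, case_names zero diff of])
    case zero
    show ?case
      using that by (simp add: tensor_free_ring_mult_left h_zero carr[symmetric])
  next
    case (diff a b)
    then have c: "a \<in> carrier env" "b \<in> carrier env" "g \<in> carrier env"
      using that by (simp_all add: carr)
    then have "Poly_Mapping.keys (a \<otimes>\<^bsub>env\<^esub> g) \<subseteq> ?S" "Poly_Mapping.keys (b \<otimes>\<^bsub>env\<^esub> g) \<subseteq> ?S"
      by (simp_all flip: carr)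
    with diff c show ?case
      by (simp add: tensor_free_ring_mult_left h_diff E.minus_eq E.l_distr E.l_minus)
  next
    case (of x)
    show ?case
      using that(2)
    proof (induction g rule: free_Abelian_group_induct[consumes 1, case_names zero diff of])
      case zero
      have "frag_of x \<in> carrier env"
        using \<open>x \<in> ?S\<close> by (simp add: carr)
      then show ?case
        by (simp add: tensor_free_ring_mult_right h_zero)
    next
      case (diff a b)
      then have c: "a \<in> carrier env" "b \<in> carrier env" "frag_of x \<in> carrier env"
        using \<open>x \<in> ?S\<close> by (simp_all add: carr)
      then have "Poly_Mapping.keys (frag_of x \<otimes>\<^bsub>env\<^esub> a) \<subseteq> ?S"
          "Poly_Mapping.keys (frag_of x \<otimes>\<^bsub>env\<^esub> b) \<subseteq> ?S"
        by (simp_all flip: carr)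
      with diff c show ?case
        by (simp add: tensor_free_ring_mult_right h_diff E.minus_eq E.r_distr E.r_minus)
    next
      case (of y)
      with \<open>x \<in> ?S\<close> show ?case
        by (cases x; cases y)
          (auto simp: tensor_free_ring_mult_of h_of endomorphism_algebra_def compose_def A.m_assoc)
    qed
  qed
  have "h \<in> ring_hom env ?E"
  proof (rule ring_hom_memI)
    show "h \<one>\<^bsub>env\<^esub> = \<one>\<^bsub>?E\<^esub>"
      by (auto simp: tensor_free_ring_simps h_of endomorphism_algebra_def)
  qed (use mult in \<open>simp_all add: carr\<close>)
  with h_of that show thesis
    by auto
qed

end

section \<open>The kernel of the tensor product\<close>

text \<open>Links the subtraction derived from the ring record with that of finitely supported
  functions, in which the relators are written.\<close>

lemma tensor_free_ring_minus:
  assumes "f \<in> carrier (tensor_free_ring A B)" "g \<in> carrier (tensor_free_ring A B)"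
  shows "f \<ominus>\<^bsub>tensor_free_ring A B\<^esub> g = f - g"
proof -
  have "\<ominus>\<^bsub>tensor_free_ring A B\<^esub> g = - g"
    using assms(2)
    by (simp only: a_inv_def add_monoid_tensor_free_ring tensor_free_ring_simps(1) inv_free_Abelian_group)
  then show ?thesis
    by (simp add: a_minus_def tensor_free_ring_simps)
qed

context assoc_algebra
begin

abbreviation ker_env :: "('c \<times> 'c \<Rightarrow>\<^sub>0 int) set"
  where "ker_env \<equiv> tensor_kernel R A (opposite_algebra A)"

lemma tensor_relators_subset: "tensor_relators R A (opposite_algebra A) \<subseteq> carrier env"
proof -
  have of: "frag_of (a, b) \<in> carrier env" if "a \<in> carrier A" "b \<in> carrier A" for a b
    using that by (simp add: tensor_free_ring_simps)
  interpret ring env by (rule ring_env)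
  have diff: "f - g \<in> carrier env" if "f \<in> carrier env" "g \<in> carrier env" for f g
    using minus_closed[OF that] that by (simp add: tensor_free_ring_minus)
  show ?thesis
    by (auto simp: tensor_relators_def intro!: of diff)
qed

lemma subgroup_ker_env: "additive_subgroup ker_env env"
proof -
  interpret ring env by (rule ring_env)
  show ?thesis
    unfolding tensor_kernel_def using tensor_relators_subset
    by (intro additive_subgroup.intro add.generate_is_subgroup) simp
qed

lemma ker_env_zero: "0 \<in> ker_env"
  using additive_subgroup.zero_closed[OF subgroup_ker_env] by (simp add: tensor_free_ring_simps)

lemma ker_env_add: "f \<in> ker_env \<Longrightarrow> g \<in> ker_env \<Longrightarrow> f + g \<in> ker_env"
  using additive_subgroup.a_closed[OF subgroup_ker_env] by (simp add: tensor_free_ring_simps)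

lemma ker_env_uminus: "f \<in> ker_env \<Longrightarrow> - f \<in> ker_env"
proof -
  interpret ring env by (rule ring_env)
  assume "f \<in> ker_env"
  moreover from this have "\<ominus>\<^bsub>env\<^esub> f \<in> ker_env" "f \<in> carrier env"
    using additive_subgroup.a_inv_closed[OF subgroup_ker_env]
      additive_subgroup.a_Hcarr[OF subgroup_ker_env] by auto
  ultimately show ?thesis
    using tensor_free_ring_minus[of 0 A "opposite_algebra A" f] zero_closed
    by (simp add: minus_eq tensor_free_ring_simps)
qed

lemma ker_env_diff: "f \<in> ker_env \<Longrightarrow> g \<in> ker_env \<Longrightarrow> f - g \<in> ker_env"
  using ker_env_add[of f "- g"] ker_env_uminus by simp

lemma ker_env_relator:
  assumes "a \<in> carrier A" "b \<in> carrier A"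
  shows "a' \<in> carrier A \<Longrightarrow> frag_of (a \<oplus>\<^bsub>A\<^esub> a', b) - frag_of (a, b) - frag_of (a', b) \<in> ker_env"
    and "b' \<in> carrier A \<Longrightarrow> frag_of (a, b \<oplus>\<^bsub>A\<^esub> b') - frag_of (a, b) - frag_of (a, b') \<in> ker_env"
    and "r \<in> carrier R \<Longrightarrow> frag_of (r \<odot>\<^bsub>A\<^esub> a, b) - frag_of (a, r \<odot>\<^bsub>A\<^esub> b) \<in> ker_env"
  unfolding tensor_kernel_def tensor_relators_def opposite_algebra_simps
  by (rule generate.incl, rule UnI1, rule UnI1, use assms in blast)
    (rule generate.incl, rule UnI1, rule UnI2, use assms in blast,
      rule generate.incl, rule UnI2, use assms in blast)

text \<open>For a = a' = 0 the relator for additivity on the left collapses to the negative of the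
  generator in question.\<close>

lemma ker_env_zero_left:
  assumes "b \<in> carrier A"
  shows "frag_of (\<zero>\<^bsub>A\<^esub>, b) \<in> ker_env"
  using ker_env_relator(1)[of "\<zero>\<^bsub>A\<^esub>" b "\<zero>\<^bsub>A\<^esub>"] ker_env_uminus[of "- frag_of (\<zero>\<^bsub>A\<^esub>, b)"] assms
  by simp

lemma ker_env_zero_right:
  assumes "a \<in> carrier A"
  shows "frag_of (a, \<zero>\<^bsub>A\<^esub>) \<in> ker_env"
  using ker_env_relator(2)[of a "\<zero>\<^bsub>A\<^esub>" "\<zero>\<^bsub>A\<^esub>"] ker_env_uminus[of "- frag_of (a, \<zero>\<^bsub>A\<^esub>)"] assms
  by simp

lemma ker_env_expand_right:
  assumes "finite B" "B \<subseteq> carrier A" "c \<in> B \<rightarrow> carrier R" "a \<in> carrier A"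
  shows "frag_of (a, \<Oplus>\<^bsub>A\<^esub>b\<in>B. c b \<odot>\<^bsub>A\<^esub> b) - (\<Sum>b\<in>B. frag_of (c b \<odot>\<^bsub>A\<^esub> a, b)) \<in> ker_env"
  using assms(1-3)
proof (induction B rule: finite_induct)
  case empty
  then show ?case
    using assms ker_env_zero_right by simp
next
  case (insert b B)
  let ?s = "\<Oplus>\<^bsub>A\<^esub>b\<in>B. c b \<odot>\<^bsub>A\<^esub> b"
  have s: "?s \<in> carrier A" and b: "b \<in> carrier A" "c b \<in> carrier R"
    using insert by (auto intro!: M.finsum_closed)
  have IH: "frag_of (a, ?s) - (\<Sum>b\<in>B. frag_of (c b \<odot>\<^bsub>A\<^esub> a, b)) \<in> ker_env"
    using insert by auto
  \<comment> \<open>The first relator splits off the summand of \<open>b\<close>, the second moves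
    its coefficient to the left factor, and the last line is the induction hypothesis; the
    intermediate generators cancel.\<close>
  have "(frag_of (a, c b \<odot>\<^bsub>A\<^esub> b \<oplus>\<^bsub>A\<^esub> ?s) - frag_of (a, c b \<odot>\<^bsub>A\<^esub> b) - frag_of (a, ?s))
      - (frag_of (c b \<odot>\<^bsub>A\<^esub> a, b) - frag_of (a, c b \<odot>\<^bsub>A\<^esub> b))
      + (frag_of (a, ?s) - (\<Sum>b\<in>B. frag_of (c b \<odot>\<^bsub>A\<^esub> a, b))) \<in> ker_env"
    using assms(4) s b
    by (intro ker_env_add[OF ker_env_diff IH] ker_env_relator) auto
  moreover have "(\<Oplus>\<^bsub>A\<^esub>b\<in>insert b B. c b \<odot>\<^bsub>A\<^esub> b) = c b \<odot>\<^bsub>A\<^esub> b \<oplus>\<^bsub>A\<^esub> ?s"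
    using insert by (subst M.finsum_insert) auto
  ultimately show ?case
    using insert by (simp add: algebra_simps)
qed

text \<open>The right entry of each generator is expanded in the basis, and the resulting normal
  forms are closed under differences. Only existence is claimed; that the coefficients of an element
  of the kernel vanish is obtained later from the dual operators.\<close>

lemma tensor_normal_form:
  assumes B: "module_basis R A B" "finite B" and t: "t \<in> carrier env"
  shows "\<exists>a\<in>B \<rightarrow> carrier A. t - (\<Sum>b\<in>B. frag_of (a b, b)) \<in> ker_env"
proof -
  have sub: "B \<subseteq> carrier A"
    using B by (rule basis_closed)
  have "Poly_Mapping.keys t \<subseteq> carrier A \<times> carrier A"
    using t by (simp add: tensor_free_ring_simps)
  then show ?thesis
  proof (induction t rule: frag_induction)
    case zero
    have "(\<Sum>b\<in>B. frag_of (\<zero>\<^bsub>A\<^esub>, b)) \<in> ker_env"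
      using B(2) sub
      by (induction B rule: finite_induct)
        (auto simp: ker_env_zero ker_env_zero_left intro: ker_env_add)
    from ker_env_diff[OF ker_env_zero this] show ?case
      by (intro bexI[of _ "\<lambda>_. \<zero>\<^bsub>A\<^esub>"]) auto
  next
    case (one z)
    then obtain x y where z: "z = (x, y)" "x \<in> carrier A" "y \<in> carrier A"
      by auto
    note c = coords[OF B z(3)]
    have "frag_of (x, y) - (\<Sum>b\<in>B. frag_of (coords B y b \<odot>\<^bsub>A\<^esub> x, b)) \<in> ker_env"
      using ker_env_expand_right[OF B(2) sub, of "coords B y" x] c z by (simp add: PiE_def)
    then show ?case
      using c z by (intro bexI[of _ "\<lambda>b. coords B y b \<odot>\<^bsub>A\<^esub> x"]) (auto simp: PiE_iff)
  next
    case (diff s t)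
    then obtain a a' where a: "a \<in> B \<rightarrow> carrier A" "a' \<in> B \<rightarrow> carrier A"
      and st: "s - (\<Sum>b\<in>B. frag_of (a b, b)) \<in> ker_env" "t - (\<Sum>b\<in>B. frag_of (a' b, b)) \<in> ker_env"
      by blast
    have "(\<Sum>b\<in>B. frag_of (a b, b)) - (\<Sum>b\<in>B. frag_of (a' b, b))
        - (\<Sum>b\<in>B. frag_of (a b \<ominus>\<^bsub>A\<^esub> a' b, b)) \<in> ker_env"
      using B(2) sub a
    proof (induction B rule: finite_induct)
      case (insert b B)
      \<comment> \<open>The relator for a b = (a b - a' b) + a' b, which compares the two normal
        forms at the single index \<open>b\<close>.\<close>
      have "frag_of ((a b \<ominus>\<^bsub>A\<^esub> a' b) \<oplus>\<^bsub>A\<^esub> a' b, b) - frag_of (a b \<ominus>\<^bsub>A\<^esub> a' b, b)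
          - frag_of (a' b, b) \<in> ker_env"
        using insert by (intro ker_env_relator) auto
      then have "frag_of (a b, b) - frag_of (a b \<ominus>\<^bsub>A\<^esub> a' b, b) - frag_of (a' b, b) \<in> ker_env"
        using insert by (simp add: M.minus_eq M.a_assoc M.l_neg Pi_iff)
      from ker_env_add[OF this insert.IH] insert show ?case
        by (simp add: algebra_simps)
    qed (simp add: ker_env_zero)
    from ker_env_add[OF ker_env_diff[OF st] this] a show ?case
      by (intro bexI[of _ "\<lambda>b. a b \<ominus>\<^bsub>A\<^esub> a' b"]) (auto simp: algebra_simps)
  qed
qed

end

section \<open>Multiplication operators\<close>

context assoc_algebra
begin

text \<open>This is the additive span \<open>M\<close> of the opening comment. Closure under sums
  suffices to generate it: zero and negatives arise because a left coefficient may be 0 or carry a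
  sign.\<close>

inductive_set mult_ops :: "('c \<Rightarrow> 'c) set" where
  two_sided: "\<lbrakk>a \<in> carrier A; b \<in> carrier A\<rbrakk> \<Longrightarrow> two_sided a b \<in> mult_ops"
| add: "\<lbrakk>f \<in> mult_ops; g \<in> mult_ops\<rbrakk> \<Longrightarrow> (\<lambda>x\<in>carrier A. f x \<oplus>\<^bsub>A\<^esub> g x) \<in> mult_ops"

lemma mult_ops_endomorphism:
  assumes "f \<in> mult_ops"
  shows "f \<in> carrier (endomorphism_algebra R A)"
  using assms
proof induction
  case (add f g)
  interpret E: ring "endomorphism_algebra R A" by (rule ring_endomorphism_algebra)
  have "f \<oplus>\<^bsub>endomorphism_algebra R A\<^esub> g = (\<lambda>x\<in>carrier A. f x \<oplus>\<^bsub>A\<^esub> g x)"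
    by (simp add: endomorphism_algebra_def)
  then show ?case
    using E.a_closed[OF add.IH] by argo
qed (rule two_sided_endomorphism)

lemma mult_ops_closed: "f \<in> mult_ops \<Longrightarrow> x \<in> carrier A \<Longrightarrow> f x \<in> carrier A"
  using mult_ops_endomorphism[of f] by (auto simp: endomorphism_algebra_def linear_maps_def)

lemma mult_ops_id: "(\<lambda>x\<in>carrier A. x) \<in> mult_ops"
proof -
  have "two_sided \<one>\<^bsub>A\<^esub> \<one>\<^bsub>A\<^esub> = (\<lambda>x\<in>carrier A. x)"
    by auto
  then show ?thesis
    using mult_ops.two_sided[of "\<one>\<^bsub>A\<^esub>" "\<one>\<^bsub>A\<^esub>"] by simp
qed

lemma mult_ops_zero: "(\<lambda>x\<in>carrier A. \<zero>\<^bsub>A\<^esub>) \<in> mult_ops"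
proof -
  have "two_sided \<zero>\<^bsub>A\<^esub> \<zero>\<^bsub>A\<^esub> = (\<lambda>x\<in>carrier A. \<zero>\<^bsub>A\<^esub>)"
    by auto
  then show ?thesis
    using mult_ops.two_sided[of "\<zero>\<^bsub>A\<^esub>" "\<zero>\<^bsub>A\<^esub>"] by simp
qed

text \<open>This closure is what later makes the values at a fixed point, of operators with
  prescribed zeros, a two-sided ideal. It also yields negatives, by multiplying with -1.\<close>

lemma mult_ops_mult:
  assumes "f \<in> mult_ops" "a \<in> carrier A" "b \<in> carrier A"
  shows "(\<lambda>x\<in>carrier A. a \<otimes>\<^bsub>A\<^esub> f x \<otimes>\<^bsub>A\<^esub> b) \<in> mult_ops"
  using assms(1)
proof induction
  case (two_sided c d)
  have "(\<lambda>x\<in>carrier A. a \<otimes>\<^bsub>A\<^esub> two_sided c d x \<otimes>\<^bsub>A\<^esub> b) = two_sided (a \<otimes>\<^bsub>A\<^esub> c) (d \<otimes>\<^bsub>A\<^esub> b)"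
    using assms two_sided by (auto simp: A.m_assoc)
  moreover have "two_sided (a \<otimes>\<^bsub>A\<^esub> c) (d \<otimes>\<^bsub>A\<^esub> b) \<in> mult_ops"
    using assms two_sided by (intro mult_ops.two_sided) auto
  ultimately show ?case
    by argo
next
  case (add f g)
  have "(\<lambda>x\<in>carrier A. a \<otimes>\<^bsub>A\<^esub> (\<lambda>x\<in>carrier A. f x \<oplus>\<^bsub>A\<^esub> g x) x \<otimes>\<^bsub>A\<^esub> b) =
      (\<lambda>x\<in>carrier A. (\<lambda>x\<in>carrier A. a \<otimes>\<^bsub>A\<^esub> f x \<otimes>\<^bsub>A\<^esub> b) x \<oplus>\<^bsub>A\<^esub> (\<lambda>x\<in>carrier A. a \<otimes>\<^bsub>A\<^esub> g x \<otimes>\<^bsub>A\<^esub> b) x)"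
    using assms add by (auto simp: A.l_distr A.r_distr mult_ops_closed)
  then show ?case
    using mult_ops.add[OF add.IH] by argo
qed

lemma mult_ops_uminus:
  assumes "f \<in> mult_ops"
  shows "(\<lambda>x\<in>carrier A. \<ominus>\<^bsub>A\<^esub> f x) \<in> mult_ops"
proof -
  have "(\<lambda>x\<in>carrier A. \<ominus>\<^bsub>A\<^esub> \<one>\<^bsub>A\<^esub> \<otimes>\<^bsub>A\<^esub> f x \<otimes>\<^bsub>A\<^esub> \<one>\<^bsub>A\<^esub>) = (\<lambda>x\<in>carrier A. \<ominus>\<^bsub>A\<^esub> f x)"
    using assms by (auto simp: A.l_minus mult_ops_closed)
  then show ?thesis
    using mult_ops_mult[OF assms, of "\<ominus>\<^bsub>A\<^esub> \<one>\<^bsub>A\<^esub>" "\<one>\<^bsub>A\<^esub>"] by auto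
qed

lemma mult_ops_diff:
  assumes "f \<in> mult_ops" "g \<in> mult_ops"
  shows "(\<lambda>x\<in>carrier A. f x \<ominus>\<^bsub>A\<^esub> g x) \<in> mult_ops"
proof -
  have "(\<lambda>x\<in>carrier A. f x \<oplus>\<^bsub>A\<^esub> (\<lambda>x\<in>carrier A. \<ominus>\<^bsub>A\<^esub> g x) x) = (\<lambda>x\<in>carrier A. f x \<ominus>\<^bsub>A\<^esub> g x)"
    by (auto simp: M.minus_eq)
  then show ?thesis
    using mult_ops.add[OF assms(1) mult_ops_uminus[OF assms(2)]] by argo
qed

lemma mult_ops_finsum:
  assumes "finite I" "\<And>i. i \<in> I \<Longrightarrow> F i \<in> mult_ops"
  shows "(\<lambda>x\<in>carrier A. \<Oplus>\<^bsub>A\<^esub>i\<in>I. F i x) \<in> mult_ops"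
  using assms
proof (induction I rule: finite_induct)
  case empty
  then show ?case using mult_ops_zero by (simp only: M.finsum_empty)
next
  case (insert i I)
  have "(\<lambda>x\<in>carrier A. \<Oplus>\<^bsub>A\<^esub>i\<in>insert i I. F i x) =
      (\<lambda>x\<in>carrier A. F i x \<oplus>\<^bsub>A\<^esub> (\<lambda>x\<in>carrier A. \<Oplus>\<^bsub>A\<^esub>i\<in>I. F i x) x)"
    using insert by (auto simp: mult_ops_closed Pi_iff intro!: M.finsum_insert)
  moreover have "(\<lambda>x\<in>carrier A. F i x \<oplus>\<^bsub>A\<^esub> (\<lambda>x\<in>carrier A. \<Oplus>\<^bsub>A\<^esub>i\<in>I. F i x) x) \<in> mult_ops"
    using insert by (intro mult_ops.add) auto
  ultimately show ?case
    by argo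
qed

text \<open>Substituting \<open>x c\<close> for \<open>x\<close> in the hypothesis and multiplying by \<open>d\<close> on the right gives the
  claim for \<open>f = (y \<mapsto> c y d)\<close>.\<close>

lemma mult_ops_annihilate:
  assumes "f \<in> mult_ops" "finite B" "B \<subseteq> carrier A" "a \<in> B \<rightarrow> carrier A" "x \<in> carrier A"
    and zero: "\<And>x. x \<in> carrier A \<Longrightarrow> (\<Oplus>\<^bsub>A\<^esub>b\<in>B. a b \<otimes>\<^bsub>A\<^esub> x \<otimes>\<^bsub>A\<^esub> b) = \<zero>\<^bsub>A\<^esub>"
  shows "(\<Oplus>\<^bsub>A\<^esub>b\<in>B. a b \<otimes>\<^bsub>A\<^esub> x \<otimes>\<^bsub>A\<^esub> f b) = \<zero>\<^bsub>A\<^esub>"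
  using assms(1)
proof induction
  case (two_sided c d)
  have "(\<Oplus>\<^bsub>A\<^esub>b\<in>B. a b \<otimes>\<^bsub>A\<^esub> x \<otimes>\<^bsub>A\<^esub> two_sided c d b) =
      (\<Oplus>\<^bsub>A\<^esub>b\<in>B. (a b \<otimes>\<^bsub>A\<^esub> (x \<otimes>\<^bsub>A\<^esub> c) \<otimes>\<^bsub>A\<^esub> b) \<otimes>\<^bsub>A\<^esub> d)"
    using assms two_sided by (intro M.finsum_cong') (auto simp: A.m_assoc Pi_iff subset_iff)
  also have "\<dots> = (\<Oplus>\<^bsub>A\<^esub>b\<in>B. a b \<otimes>\<^bsub>A\<^esub> (x \<otimes>\<^bsub>A\<^esub> c) \<otimes>\<^bsub>A\<^esub> b) \<otimes>\<^bsub>A\<^esub> d"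
    using assms two_sided by (intro A.finsum_ldistr[symmetric]) auto
  finally show ?case
    using zero[of "x \<otimes>\<^bsub>A\<^esub> c"] assms two_sided by simp
next
  case (add f g)
  have "(\<Oplus>\<^bsub>A\<^esub>b\<in>B. a b \<otimes>\<^bsub>A\<^esub> x \<otimes>\<^bsub>A\<^esub> (\<lambda>x\<in>carrier A. f x \<oplus>\<^bsub>A\<^esub> g x) b) =
      (\<Oplus>\<^bsub>A\<^esub>b\<in>B. a b \<otimes>\<^bsub>A\<^esub> x \<otimes>\<^bsub>A\<^esub> f b \<oplus>\<^bsub>A\<^esub> a b \<otimes>\<^bsub>A\<^esub> x \<otimes>\<^bsub>A\<^esub> g b)"
    using assms add by (intro M.finsum_cong') (auto simp: A.r_distr Pi_iff subset_iff mult_ops_closed)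
  also have "\<dots> = (\<Oplus>\<^bsub>A\<^esub>b\<in>B. a b \<otimes>\<^bsub>A\<^esub> x \<otimes>\<^bsub>A\<^esub> f b) \<oplus>\<^bsub>A\<^esub> (\<Oplus>\<^bsub>A\<^esub>b\<in>B. a b \<otimes>\<^bsub>A\<^esub> x \<otimes>\<^bsub>A\<^esub> g b)"
    using assms add by (intro M.finsum_addf) (auto simp: mult_ops_closed Pi_iff subset_iff)
  finally show ?case
    using add.IH by simp
qed

end

section \<open>The natural map\<close>

context assoc_algebra
begin

text \<open>Scalars act on representatives as multiplication by r1 \<otimes> 1, so a ring
  homomorphism on \<open>env\<close> automatically controls the scalar action.\<close>

lemma tensor_scalar_eq_mult:
  assumes "r \<in> carrier R" "f \<in> carrier env"
  shows "frag_extend (\<lambda>(a, b). frag_of (r \<odot>\<^bsub>A\<^esub> a, b)) f =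
    frag_of (r \<odot>\<^bsub>A\<^esub> \<one>\<^bsub>A\<^esub>, \<one>\<^bsub>A\<^esub>) \<otimes>\<^bsub>env\<^esub> f"
proof -
  have "Poly_Mapping.keys f \<subseteq> carrier A \<times> carrier A"
    using assms by (simp add: tensor_free_ring_simps)
  then show ?thesis
    using assms(1) unfolding tensor_free_ring_def
    by (auto intro!: frag_extend_eq simp: smult_mult_left)
qed

abbreviation endo :: "('a, 'c \<Rightarrow> 'c) module"
  where "endo \<equiv> endomorphism_algebra R A"

lemma frag_of_in_env: "a \<in> carrier A \<Longrightarrow> b \<in> carrier A \<Longrightarrow> frag_of (a, b) \<in> carrier env"
  by (simp add: tensor_free_ring_simps)

lemma zero_endo: "\<zero>\<^bsub>endo\<^esub> = (\<lambda>x\<in>carrier A. \<zero>\<^bsub>A\<^esub>)"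
  by (simp add: endomorphism_algebra_def)

context
  fixes h
  assumes h_ring_hom: "h \<in> ring_hom env endo"
    and h_of: "\<And>a b. a \<in> carrier A \<Longrightarrow> b \<in> carrier A \<Longrightarrow> h (frag_of (a, b)) = two_sided a b"
begin

interpretation h: ring_hom_ring env endo h
  by (intro ring_hom_ringI2 ring_env ring_endomorphism_algebra h_ring_hom)

lemma hom_env_add:
  assumes "f \<in> carrier env" "g \<in> carrier env"
  shows "h (f + g) = (\<lambda>x\<in>carrier A. h f x \<oplus>\<^bsub>A\<^esub> h g x)"
  using h.hom_add[OF assms] by (simp add: tensor_free_ring_simps endomorphism_algebra_def)

lemma hom_env_zero: "h 0 = \<zero>\<^bsub>endo\<^esub>"
  using h.hom_zero by (simp add: tensor_free_ring_simps)

lemma hom_env_diff: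
  assumes "f \<in> carrier env" "g \<in> carrier env"
  shows "h (f - g) = h f \<ominus>\<^bsub>endo\<^esub> h g" and "f - g \<in> carrier env"
  using assms h.R.minus_closed[OF assms]
  by (simp_all add: h.R.minus_eq h.S.minus_eq flip: tensor_free_ring_minus)

text \<open>The operator x \<mapsto> a x b is additive in \<open>a\<close> and in \<open>b\<close>,
  and a scalar can be moved from one to the other. So \<open>h\<close> kills every relator, and its
  kernel, being a subgroup, contains all that they generate.\<close>

lemma tensor_kernel_subset: "ker_env \<subseteq> a_kernel env endo h"
proof -
  have "tensor_relators R A (opposite_algebra A) \<subseteq> a_kernel env endo h"
  proof
    have eqI: "h (f - g) = \<zero>\<^bsub>endo\<^esub>"
      if "f \<in> carrier env" "g \<in> carrier env" "h f = h g" for f g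
      using that by (simp add: hom_env_diff(1) h.S.minus_eq h.S.r_neg)
    have eqI2: "h (f - g - g') = \<zero>\<^bsub>endo\<^esub>"
      if "f \<in> carrier env" "g \<in> carrier env" "g' \<in> carrier env" "h f = h g \<oplus>\<^bsub>endo\<^esub> h g'" for f g g'
    proof -
      have "h (f - (g + g')) = \<zero>\<^bsub>endo\<^esub>"
        using eqI[of f "g \<oplus>\<^bsub>env\<^esub> g'"] that h.R.a_closed[OF that(2,3)] h.hom_add[OF that(2,3)]
        by (simp add: tensor_free_ring_simps(2))
      then show ?thesis
        by (simp add: diff_diff_eq)
    qed
    fix t assume "t \<in> tensor_relators R A (opposite_algebra A)"
    then have "t \<in> carrier env \<and> h t = \<zero>\<^bsub>endo\<^esub>"
      unfolding tensor_relators_def opposite_algebra_simps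
    proof (elim UnE CollectE exE conjE)
      fix a a' b
      assume t: "t = frag_of (a \<oplus>\<^bsub>A\<^esub> a', b) - frag_of (a, b) - frag_of (a', b)"
        and a: "a \<in> carrier A" "a' \<in> carrier A" "b \<in> carrier A"
      then have "h (frag_of (a \<oplus>\<^bsub>A\<^esub> a', b)) = h (frag_of (a, b)) \<oplus>\<^bsub>endo\<^esub> h (frag_of (a', b))"
        by (auto simp: h_of A.l_distr endomorphism_algebra_def)
      with a show ?thesis
        unfolding t by (intro conjI eqI2 hom_env_diff(2) frag_of_in_env M.a_closed)
    next
      fix a b b'
      assume t: "t = frag_of (a, b \<oplus>\<^bsub>A\<^esub> b') - frag_of (a, b) - frag_of (a, b')"
        and a: "a \<in> carrier A" "b \<in> carrier A" "b' \<in> carrier A"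
      then have "h (frag_of (a, b \<oplus>\<^bsub>A\<^esub> b')) = h (frag_of (a, b)) \<oplus>\<^bsub>endo\<^esub> h (frag_of (a, b'))"
        by (auto simp: h_of A.r_distr endomorphism_algebra_def)
      with a show ?thesis
        unfolding t by (intro conjI eqI2 hom_env_diff(2) frag_of_in_env M.a_closed)
    next
      fix r a b
      assume t: "t = frag_of (r \<odot>\<^bsub>A\<^esub> a, b) - frag_of (a, r \<odot>\<^bsub>A\<^esub> b)"
        and a: "r \<in> carrier R" "a \<in> carrier A" "b \<in> carrier A"
      then have "h (frag_of (r \<odot>\<^bsub>A\<^esub> a, b)) = h (frag_of (a, r \<odot>\<^bsub>A\<^esub> b))"
        by (auto simp: h_of smult_mult_left smult_mult_right)
      with a show ?thesis
        unfolding t by (intro conjI eqI hom_env_diff(2) frag_of_in_env smult_closed)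
    qed
    then show "t \<in> a_kernel env endo h"
      unfolding a_kernel_def' by blast
  qed
  then show ?thesis
    unfolding tensor_kernel_def
    by (intro h.R.add.generate_subgroup_incl additive_subgroup.a_subgroup h.additive_subgroup_a_kernel)
qed

lemma mult_ops_subset_image: "mult_ops \<subseteq> h ` carrier env"
proof
  fix f assume "f \<in> mult_ops"
  then show "f \<in> h ` carrier env"
  proof induction
    case (two_sided a b)
    then show ?case
      using h_of frag_of_in_env by (metis imageI)
  next
    case (add f g)
    then obtain s t where st: "s \<in> carrier env" "t \<in> carrier env" and "f = h s" "g = h t"
      by blast
    then have "(\<lambda>x\<in>carrier A. f x \<oplus>\<^bsub>A\<^esub> g x) = h (s + t)"
      by (simp only: hom_env_add)
    moreover have "s + t \<in> carrier env"
      using h.R.a_closed[OF st] by (simp add: tensor_free_ring_simps(2))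
    ultimately show ?case
      by blast
  qed
qed

text \<open>Replace an element of the kernel by its normal form: the vanishing of its image is an
  identity \<Sum> a b x b = 0 for all x, and \<open>indep\<close> makes every coefficient zero. The
  normal form is then a sum of tensors with left entry 0.\<close>

lemma kernel_subset:
  assumes basis: "module_basis R A B" and finite_basis: "finite B"
    and indep: "\<And>a b. a \<in> B \<rightarrow> carrier A \<Longrightarrow>
      (\<And>x. x \<in> carrier A \<Longrightarrow> (\<Oplus>\<^bsub>A\<^esub>b\<in>B. a b \<otimes>\<^bsub>A\<^esub> x \<otimes>\<^bsub>A\<^esub> b) = \<zero>\<^bsub>A\<^esub>) \<Longrightarrow>
      b \<in> B \<Longrightarrow> a b = \<zero>\<^bsub>A\<^esub>"
  shows "a_kernel env endo h \<subseteq> ker_env"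
proof
  have sub: "B \<subseteq> carrier A"
    by (rule basis_closed[OF basis finite_basis])
  fix t assume t: "t \<in> a_kernel env endo h"
  then have t_env: "t \<in> carrier env" and t_zero: "h t = \<zero>\<^bsub>endo\<^esub>"
    unfolding a_kernel_def' by blast+
  obtain a where a: "a \<in> B \<rightarrow> carrier A" and t_a: "t - (\<Sum>b\<in>B. frag_of (a b, b)) \<in> ker_env"
    using tensor_normal_form[OF basis finite_basis t_env] by blast
  let ?s = "\<lambda>B. \<Sum>b\<in>B. frag_of (a b, b)"
  have s: "?s B' \<in> carrier env \<and> (\<forall>x\<in>carrier A. h (?s B') x = (\<Oplus>\<^bsub>A\<^esub>b\<in>B'. a b \<otimes>\<^bsub>A\<^esub> x \<otimes>\<^bsub>A\<^esub> b))"
    if "B' \<subseteq> B" for B'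
    using finite_subset[OF that finite_basis] that
  proof (induction B' rule: finite_induct)
    case empty
    then show ?case
      using h.R.zero_closed by (simp add: hom_env_zero zero_endo tensor_free_ring_simps)
  next
    case (insert b B')
    then have b: "b \<in> carrier A" "a b \<in> carrier A" and IH: "?s B' \<in> carrier env"
        "\<And>x. x \<in> carrier A \<Longrightarrow> h (?s B') x = (\<Oplus>\<^bsub>A\<^esub>b\<in>B'. a b \<otimes>\<^bsub>A\<^esub> x \<otimes>\<^bsub>A\<^esub> b)"
      using sub a by auto
    have "h (?s (insert b B')) x = (\<Oplus>\<^bsub>A\<^esub>b\<in>insert b B'. a b \<otimes>\<^bsub>A\<^esub> x \<otimes>\<^bsub>A\<^esub> b)" if x: "x \<in> carrier A" for x
    proof -
      have "(\<Oplus>\<^bsub>A\<^esub>b\<in>insert b B'. a b \<otimes>\<^bsub>A\<^esub> x \<otimes>\<^bsub>A\<^esub> b) =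
          a b \<otimes>\<^bsub>A\<^esub> x \<otimes>\<^bsub>A\<^esub> b \<oplus>\<^bsub>A\<^esub> (\<Oplus>\<^bsub>A\<^esub>b\<in>B'. a b \<otimes>\<^bsub>A\<^esub> x \<otimes>\<^bsub>A\<^esub> b)"
        using insert a sub x b by (intro M.finsum_insert) (auto simp: Pi_iff subset_iff)
      then show ?thesis
        using insert.hyps x b IH by (simp add: hom_env_add frag_of_in_env h_of)
    qed
    moreover have "?s (insert b B') \<in> carrier env"
      using h.R.a_closed[OF frag_of_in_env[OF b(2,1)] IH(1)] insert.hyps by (simp add: tensor_free_ring_simps(2))
    ultimately show ?case
      by blast
  qed
  \<comment> \<open>\<open>t\<close> and its normal form differ by relations, which \<open>h\<close>
    kills; hence \<open>h\<close> vanishes on the normal form as well.\<close>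
  have "t - ?s B \<in> carrier env" "h (t - ?s B) = \<zero>\<^bsub>endo\<^esub>"
    using t_a tensor_kernel_subset unfolding a_kernel_def' by blast+
  then have "h (t - (t - ?s B)) = \<zero>\<^bsub>endo\<^esub>"
    using t_env t_zero by (subst hom_env_diff(1)) (simp_all add: h.S.minus_eq h.S.r_neg)
  then have "h (?s B) = (\<lambda>x\<in>carrier A. \<zero>\<^bsub>A\<^esub>)"
    by (simp add: zero_endo)
  then have zero: "(\<Oplus>\<^bsub>A\<^esub>b\<in>B. a b \<otimes>\<^bsub>A\<^esub> x \<otimes>\<^bsub>A\<^esub> b) = \<zero>\<^bsub>A\<^esub>" if "x \<in> carrier A" for x
    using conjunct2[OF s[OF order_refl]] that by simp
  have "?s B' \<in> ker_env" if "B' \<subseteq> B" for B'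
    using finite_subset[OF that finite_basis] that
  proof (induction B' rule: finite_induct)
    case (insert b B')
    then have "a b = \<zero>\<^bsub>A\<^esub>" "b \<in> carrier A"
      using indep[OF a zero] sub by auto
    then show ?case
      using insert by (simp add: ker_env_add ker_env_zero_left)
  qed (simp add: ker_env_zero)
  from ker_env_add[OF t_a this[OF order_refl]] show "t \<in> ker_env"
    by simp
qed

text \<open>This is the first isomorphism theorem, with \<open>the_elem\<close> picking the common
  value of \<open>h\<close> on a coset. What remains beyond rings is compatibility with the scalar
  action.\<close>

lemma natural_map_iso_of_kernel:
  assumes ker: "ker_env = a_kernel env endo h" and surj: "h ` carrier env = carrier endo"
  shows "(\<lambda>C. the_elem (h ` C)) \<in> algebra_isos R (tensor_algebra R A (opposite_algebra A)) endo"
    and "\<lbrakk>a \<in> carrier A; b \<in> carrier A\<rbrakk> \<Longrightarrow>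
      the_elem (h ` pure_tensor R A (opposite_algebra A) a b) = two_sided a b"
proof -
  let ?T = "tensor_algebra R A (opposite_algebra A)"
  let ?\<Phi> = "\<lambda>C. the_elem (h ` C)"
  \<comment> \<open>\<open>tensor_algebra\<close> has the same ring operations as the quotient ring,
    so the ring isomorphism carries over to it.\<close>
  have \<Phi>: "?\<Phi> \<in> ring_iso ?T endo"
    using h.FactRing_iso_set[OF surj, folded ker]
    by (simp add: ring_iso_def ring_hom_def tensor_algebra_def Let_def)
  have const: "h g = h f" if "f \<in> carrier env" "g \<in> ker_env +>\<^bsub>env\<^esub> f" for f g
    using that unfolding ker by (rule h.rcos_imp_homeq)
  have mem: "f \<in> ker_env +>\<^bsub>env\<^esub> f" if "f \<in> carrier env" for f
    unfolding ker using that by (intro h.homeq_imp_rcos) simp_all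
  have coset: "h ` (ker_env +>\<^bsub>env\<^esub> f) = {h f}" if "f \<in> carrier env" for f
    using const[OF that] mem[OF that] by blast
  have "?\<Phi> (r \<odot>\<^bsub>?T\<^esub> C) = r \<odot>\<^bsub>endo\<^esub> ?\<Phi> C" if r: "r \<in> carrier R" and C: "C \<in> carrier ?T" for r C
  proof -
    let ?m = "frag_extend (\<lambda>(a, b). frag_of (r \<odot>\<^bsub>A\<^esub> a, b))"
    let ?c = "frag_of (r \<odot>\<^bsub>A\<^esub> \<one>\<^bsub>A\<^esub>, \<one>\<^bsub>A\<^esub>)"
    obtain f where f: "f \<in> carrier env" "C = ker_env +>\<^bsub>env\<^esub> f"
      using C by (auto simp: tensor_algebra_def Let_def FactRing_def A_RCOSETS_def' a_r_coset_def)
    have c: "?c \<in> carrier env"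
      using r by (intro frag_of_in_env) auto
    have X_eq: "g \<in> carrier env \<and> h g = h f" if "g \<in> C" for g
      using that f h.rcos_imp_homeq[OF f(1)] h.R.a_r_coset_subset_G[of ker_env f]
        h.additive_subgroup_a_kernel additive_subgroup.a_subset by (auto simp: ker)
    have m: "h (?m g) = r \<odot>\<^bsub>endo\<^esub> h f \<and> ?m g \<in> carrier env" if g: "g \<in> C" for g
    proof -
      have "h g \<in> carrier A \<rightarrow> carrier A"
        using h.hom_closed[of g] X_eq[OF g] by (auto simp: endomorphism_algebra_def linear_maps_def)
      then have "h ?c \<otimes>\<^bsub>endo\<^esub> h g = r \<odot>\<^bsub>endo\<^esub> h g"
        using r by (auto simp: h_of endomorphism_algebra_def compose_def smult_mult_left Pi_iff fun_eq_iff)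
      then show ?thesis
        using X_eq[OF g] c r by (simp add: tensor_scalar_eq_mult)
    qed
    have "f \<in> C"
      using h.homeq_imp_rcos[OF f(1) f(1) refl] f by (simp add: ker)
    \<comment> \<open>The scalar multiple is defined as a union over all representatives of
      \<open>C\<close>. By \<open>m\<close> each coset in this union has the same image, so the
      union is mapped to one value.\<close>
    have "r \<odot>\<^bsub>?T\<^esub> C = (\<Union>g\<in>C. ker_env +>\<^bsub>env\<^esub> ?m g)"
      by (simp add: tensor_algebra_def Let_def)
    also have "h ` \<dots> = (\<Union>g\<in>C. {h (?m g)})"
      using m coset by (simp add: image_UN)
    also have "\<dots> = {r \<odot>\<^bsub>endo\<^esub> h f}"
      using m \<open>f \<in> C\<close> by auto
    finally show ?thesis
      using coset[OF f(1)] f(2) by simp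
  qed
  then have "?\<Phi> \<in> linear_maps R ?T endo"
    using \<Phi> by (auto simp: linear_maps_def ring_iso_def ring_hom_def)
  with \<Phi> show "?\<Phi> \<in> algebra_isos R ?T endo"
    unfolding algebra_isos_def by blast
  show "?\<Phi> (pure_tensor R A (opposite_algebra A) a b) = two_sided a b"
    if "a \<in> carrier A" "b \<in> carrier A"
    using coset[OF frag_of_in_env[OF that]] h_of[OF that] unfolding pure_tensor_def by simp
qed

end

section \<open>Consequences of the existence of dual operators\<close>

context
  fixes B
  assumes basis: "module_basis R A B" and finite_basis: "finite B"
    and dual: "\<And>b. b \<in> B \<Longrightarrow>
      \<exists>T\<in>mult_ops. T b = \<one>\<^bsub>A\<^esub> \<and> (\<forall>b'\<in>B - {b}. T b' = \<zero>\<^bsub>A\<^esub>)"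
begin

lemma endomorphism_in_mult_ops:
  assumes f: "f \<in> carrier (endomorphism_algebra R A)"
  shows "f \<in> mult_ops"
proof -
  obtain T where T: "\<And>b. b \<in> B \<Longrightarrow> T b \<in> mult_ops" "\<And>b. b \<in> B \<Longrightarrow> T b b = \<one>\<^bsub>A\<^esub>"
      "\<And>b b'. b \<in> B \<Longrightarrow> b' \<in> B - {b} \<Longrightarrow> T b b' = \<zero>\<^bsub>A\<^esub>"
    using dual by metis
  have sub: "B \<subseteq> carrier A"
    by (rule basis_closed[OF basis finite_basis])
  have lin: "f \<in> linear_maps R A A" "f \<in> extensional (carrier A)"
    using f by (auto simp: endomorphism_algebra_def)
  then have fB: "f b \<in> carrier A" if "b \<in> B" for b
    using that sub by (auto simp: linear_maps_def)
  \<comment> \<open>This is \<Sum> f(b) T(b); the trailing factor 1 gives each summand the form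
    required by \<open>mult_ops_mult\<close>. It remains to compare \<open>g\<close> with
    \<open>f\<close> on the basis.\<close>
  define g where "g = (\<lambda>x\<in>carrier A. \<Oplus>\<^bsub>A\<^esub>b\<in>B. (\<lambda>x\<in>carrier A. f b \<otimes>\<^bsub>A\<^esub> T b x \<otimes>\<^bsub>A\<^esub> \<one>\<^bsub>A\<^esub>) x)"
  have g: "g \<in> mult_ops"
    unfolding g_def using finite_basis T(1) fB by (intro mult_ops_finsum mult_ops_mult) auto
  have g_lin: "g \<in> linear_maps R A A" "g \<in> extensional (carrier A)"
    using mult_ops_endomorphism[OF g] by (auto simp: endomorphism_algebra_def)
  have "g b = f b" if b: "b \<in> B" for b
  proof -
    have "g b = (\<Oplus>\<^bsub>A\<^esub>b'\<in>B. f b' \<otimes>\<^bsub>A\<^esub> T b' b \<otimes>\<^bsub>A\<^esub> \<one>\<^bsub>A\<^esub>)"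
      using b sub by (auto simp: g_def)
    also have "\<dots> = (\<Oplus>\<^bsub>A\<^esub>b'\<in>B. if b = b' then f b' else \<zero>\<^bsub>A\<^esub>)"
    proof (rule M.finsum_cong'[OF refl])
      fix b' assume "b' \<in> B"
      then show "f b' \<otimes>\<^bsub>A\<^esub> T b' b \<otimes>\<^bsub>A\<^esub> \<one>\<^bsub>A\<^esub> = (if b = b' then f b' else \<zero>\<^bsub>A\<^esub>)"
        using T(2)[of b'] T(3)[of b' b] b fB[of b'] by auto
    qed (use fB in auto)
    also have "\<dots> = f b"
      using b finite_basis fB by (intro M.add.finprod_singleton) auto
    finally show ?thesis .
  qed
  then have "(\<Oplus>\<^bsub>A\<^esub>b\<in>B. coords B x b \<odot>\<^bsub>A\<^esub> f b) = (\<Oplus>\<^bsub>A\<^esub>b\<in>B. coords B x b \<odot>\<^bsub>A\<^esub> g b)"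
    if "x \<in> carrier A" for x
    using coords[OF basis finite_basis that] fB by (intro M.finsum_cong') (auto simp: PiE_iff)
  then have "f x = g x" if "x \<in> carrier A" for x
    using that linear_map_coords[OF basis finite_basis M.abelian_group_axioms] lin g_lin by simp
  then have "f = g"
    using lin(2) g_lin(2) by (rule extensionalityI[rotated 2])
  with g show ?thesis
    by simp
qed

text \<open>\<open>mult_ops_annihilate\<close> replaces the right factors b' by the values T b', of
  which only the one at \<open>b\<close> survives.\<close>

lemma dual_independent:
  assumes a: "a \<in> B \<rightarrow> carrier A" and b: "b \<in> B"
    and zero: "\<And>x. x \<in> carrier A \<Longrightarrow> (\<Oplus>\<^bsub>A\<^esub>b\<in>B. a b \<otimes>\<^bsub>A\<^esub> x \<otimes>\<^bsub>A\<^esub> b) = \<zero>\<^bsub>A\<^esub>"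
  shows "a b = \<zero>\<^bsub>A\<^esub>"
proof -
  have sub: "B \<subseteq> carrier A"
    by (rule basis_closed[OF basis finite_basis])
  obtain T where T: "T \<in> mult_ops" "T b = \<one>\<^bsub>A\<^esub>" "\<And>b'. b' \<in> B - {b} \<Longrightarrow> T b' = \<zero>\<^bsub>A\<^esub>"
    using dual[OF b] by blast
  have "(\<Oplus>\<^bsub>A\<^esub>b'\<in>B. a b' \<otimes>\<^bsub>A\<^esub> \<one>\<^bsub>A\<^esub> \<otimes>\<^bsub>A\<^esub> T b') = (\<Oplus>\<^bsub>A\<^esub>b'\<in>B. if b = b' then a b' else \<zero>\<^bsub>A\<^esub>)"
    using T(2,3) a by (intro M.finsum_cong') (auto simp: Pi_iff)
  also have "\<dots> = a b"
    using b finite_basis a by (intro M.add.finprod_singleton) auto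
  finally show ?thesis
    using mult_ops_annihilate[OF T(1) finite_basis sub a A.one_closed zero] by simp
qed

lemma natural_map_iso:
  "\<exists>\<Phi>\<in>algebra_isos R (tensor_algebra R A (opposite_algebra A)) endo.
     \<forall>a\<in>carrier A. \<forall>b\<in>carrier A. \<Phi> (pure_tensor R A (opposite_algebra A) a b) = two_sided a b"
proof -
  obtain h where h: "h \<in> ring_hom env endo"
    "\<And>a b. a \<in> carrier A \<Longrightarrow> b \<in> carrier A \<Longrightarrow> h (frag_of (a, b)) = two_sided a b"
    using two_sided_hom by blast
  have "carrier endo \<subseteq> h ` carrier env"
    using endomorphism_in_mult_ops mult_ops_subset_image[OF h] by blast
  then have surj: "h ` carrier env = carrier endo"
    using ring_hom_closed[OF h(1)] by blast
  have "a_kernel env endo h \<subseteq> ker_env"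
    using dual_independent by (intro kernel_subset[OF h basis finite_basis]) blast+
  then have ker: "ker_env = a_kernel env endo h"
    using tensor_kernel_subset[OF h] by blast
  show ?thesis
    by (intro bexI[OF _ natural_map_iso_of_kernel(1)[OF h ker surj]] ballI
        natural_map_iso_of_kernel(2)[OF h ker surj])
qed

lemma azumaya_of_dual_basis:
  assumes "faithful_module R A"
  shows "azumaya_algebra R A"
  unfolding azumaya_algebra_def faithfully_projective_def
  using assms natural_map_iso finitely_generated_of_basis[OF basis finite_basis]
    projective_of_basis[OF basis finite_basis] assoc_algebra_axioms
  by auto

end
end

section \<open>Graded rings and graded density\<close>

context graded_ring
begin

definition component :: "'a \<Rightarrow> 'g \<Rightarrow> 'a"
  where "component x = (THE c. c \<in> (\<Pi>\<^sub>E \<gamma>\<in>carrier \<Gamma>. Rg \<gamma>) \<and> finite {\<gamma> \<in> carrier \<Gamma>. c \<gamma> \<noteq> \<zero>} \<and>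
    x = (\<Oplus>\<gamma>\<in>{\<gamma> \<in> carrier \<Gamma>. c \<gamma> \<noteq> \<zero>}. c \<gamma>))"

lemma Rg_subgroup: "\<gamma> \<in> carrier \<Gamma> \<Longrightarrow> additive_subgroup (Rg \<gamma>) R"
  using grading_direct_sum by (auto simp: internal_direct_sum_def)

lemma Rg_closed: "\<gamma> \<in> carrier \<Gamma> \<Longrightarrow> x \<in> Rg \<gamma> \<Longrightarrow> x \<in> carrier R"
  using Rg_subgroup additive_subgroup.a_Hcarr by metis

lemma Rg_zero: "\<gamma> \<in> carrier \<Gamma> \<Longrightarrow> \<zero> \<in> Rg \<gamma>"
  using Rg_subgroup additive_subgroup.zero_closed by metis

lemma Rg_add: "\<gamma> \<in> carrier \<Gamma> \<Longrightarrow> x \<in> Rg \<gamma> \<Longrightarrow> y \<in> Rg \<gamma> \<Longrightarrow> x \<oplus> y \<in> Rg \<gamma>"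
  using Rg_subgroup additive_subgroup.a_closed by metis

lemma component:
  assumes "x \<in> carrier R"
  shows "component x \<in> (\<Pi>\<^sub>E \<gamma>\<in>carrier \<Gamma>. Rg \<gamma>)"
    and "finite {\<gamma> \<in> carrier \<Gamma>. component x \<gamma> \<noteq> \<zero>}"
    and "(\<Oplus>\<gamma>\<in>{\<gamma> \<in> carrier \<Gamma>. component x \<gamma> \<noteq> \<zero>}. component x \<gamma>) = x"
proof -
  have "\<exists>!c. c \<in> (\<Pi>\<^sub>E \<gamma>\<in>carrier \<Gamma>. Rg \<gamma>) \<and> finite {\<gamma> \<in> carrier \<Gamma>. c \<gamma> \<noteq> \<zero>} \<and>
    x = (\<Oplus>\<gamma>\<in>{\<gamma> \<in> carrier \<Gamma>. c \<gamma> \<noteq> \<zero>}. c \<gamma>)"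
    using grading_direct_sum assms by (auto simp: internal_direct_sum_def)
  from theI'[OF this] show "component x \<in> (\<Pi>\<^sub>E \<gamma>\<in>carrier \<Gamma>. Rg \<gamma>)"
    and "finite {\<gamma> \<in> carrier \<Gamma>. component x \<gamma> \<noteq> \<zero>}"
    and "(\<Oplus>\<gamma>\<in>{\<gamma> \<in> carrier \<Gamma>. component x \<gamma> \<noteq> \<zero>}. component x \<gamma>) = x"
    unfolding component_def[symmetric] by auto
qed

lemma component_in: "x \<in> carrier R \<Longrightarrow> \<gamma> \<in> carrier \<Gamma> \<Longrightarrow> component x \<gamma> \<in> Rg \<gamma>"
  using component(1) by auto

lemma component_closed: "x \<in> carrier R \<Longrightarrow> \<gamma> \<in> carrier \<Gamma> \<Longrightarrow> component x \<gamma> \<in> carrier R"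
  using component_in Rg_closed by blast

text \<open>\<open>S\<close> may exceed the support, so that decompositions of several elements can
  be compared over one index set.\<close>

lemma component_unique:
  assumes "c \<in> (\<Pi>\<^sub>E \<gamma>\<in>carrier \<Gamma>. Rg \<gamma>)" "finite S" "S \<subseteq> carrier \<Gamma>"
    "\<And>\<gamma>. \<gamma> \<in> carrier \<Gamma> - S \<Longrightarrow> c \<gamma> = \<zero>" "x = (\<Oplus>\<gamma>\<in>S. c \<gamma>)"
  shows "component x = c"
proof -
  let ?T = "{\<gamma> \<in> carrier \<Gamma>. c \<gamma> \<noteq> \<zero>}"
  have c: "c \<gamma> \<in> carrier R" if "\<gamma> \<in> carrier \<Gamma>" for \<gamma>
    using assms(1) that Rg_closed by auto
  have "?T \<subseteq> S"
    using assms(4) by auto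
  then have fin: "finite ?T"
    using assms(2) finite_subset by blast
  have "(\<Oplus>\<gamma>\<in>?T. c \<gamma>) = (\<Oplus>\<gamma>\<in>S. c \<gamma>)"
    by (rule add.finprod_mono_neutral_cong_left) (use assms \<open>?T \<subseteq> S\<close> c in auto)
  moreover have "x \<in> carrier R"
    using assms c by (auto intro!: finsum_closed)
  then have "\<exists>!c. c \<in> (\<Pi>\<^sub>E \<gamma>\<in>carrier \<Gamma>. Rg \<gamma>) \<and> finite {\<gamma> \<in> carrier \<Gamma>. c \<gamma> \<noteq> \<zero>} \<and>
    x = (\<Oplus>\<gamma>\<in>{\<gamma> \<in> carrier \<Gamma>. c \<gamma> \<noteq> \<zero>}. c \<gamma>)"
    using grading_direct_sum by (auto simp: internal_direct_sum_def)
  ultimately show ?thesis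
    unfolding component_def using assms(1,5) fin by (intro the1_equality) auto
qed

lemma component_homogeneous:
  assumes "\<gamma> \<in> carrier \<Gamma>" "x \<in> Rg \<gamma>"
  shows "component x = (\<lambda>\<delta>\<in>carrier \<Gamma>. if \<delta> = \<gamma> then x else \<zero>)"
  by (rule component_unique[of _ "{\<gamma>}"]) (use assms Rg_zero Rg_closed in auto)

lemma component_add:
  assumes "x \<in> carrier R" "y \<in> carrier R"
  shows "component (x \<oplus> y) = (\<lambda>\<gamma>\<in>carrier \<Gamma>. component x \<gamma> \<oplus> component y \<gamma>)"
proof -
  let ?S = "\<lambda>x. {\<gamma> \<in> carrier \<Gamma>. component x \<gamma> \<noteq> \<zero>}"
  \<comment> \<open>Over the union of both supports the decompositions add termwise. Cancellation
    may shrink the support of the sum, which \<open>component_unique\<close> permits.\<close>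
  let ?U = "?S x \<union> ?S y"
  have fin: "finite ?U"
    using component(2) assms by auto
  have ext: "(\<Oplus>\<gamma>\<in>?U. component z \<gamma>) = z" if "z \<in> carrier R" "?S z \<subseteq> ?U" for z
    using that fin component(3)[OF that(1)] component_closed
    by (subst (2) component(3)[symmetric, OF that(1)], intro add.finprod_mono_neutral_cong_right) auto
  have "x \<oplus> y = (\<Oplus>\<gamma>\<in>?U. component x \<gamma>) \<oplus> (\<Oplus>\<gamma>\<in>?U. component y \<gamma>)"
    using ext assms by auto
  also have "\<dots> = (\<Oplus>\<gamma>\<in>?U. component x \<gamma> \<oplus> component y \<gamma>)"
    using assms component_closed by (intro finsum_addf[symmetric]) auto
  also have "\<dots> = (\<Oplus>\<gamma>\<in>?U. (\<lambda>\<gamma>\<in>carrier \<Gamma>. component x \<gamma> \<oplus> component y \<gamma>) \<gamma>)"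
    using assms component_closed by (intro finsum_cong') auto
  finally show ?thesis
    using fin assms by (intro component_unique[of _ ?U]) (auto intro!: Rg_add component_in)
qed

lemma homogeneous_induct [consumes 1, case_names homogeneous add]:
  assumes "x \<in> carrier R"
    and homogeneous: "\<And>\<gamma> x. \<gamma> \<in> carrier \<Gamma> \<Longrightarrow> x \<in> Rg \<gamma> \<Longrightarrow> P x"
    and add: "\<And>x y. x \<in> carrier R \<Longrightarrow> y \<in> carrier R \<Longrightarrow> P x \<Longrightarrow> P y \<Longrightarrow> P (x \<oplus> y)"
  shows "P x"
proof -
  have "P (\<Oplus>\<gamma>\<in>S. component x \<gamma>)" if "finite S" "S \<subseteq> carrier \<Gamma>" for S
    using that
  proof (induction S rule: finite_induct)
    case empty
    \<comment> \<open>The empty sum is covered because 0 is homogeneous, here of neutral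
      degree.\<close>
    show ?case
      using homogeneous[OF Gam.one_closed Rg_zero[OF Gam.one_closed]] by simp
  next
    case (insert \<gamma> S)
    have "component x \<in> S \<rightarrow> carrier R"
      using insert component_closed[OF assms(1)] by auto
    moreover have "P (component x \<gamma>)"
      using insert.prems component_in[OF assms(1)] by (intro homogeneous[of \<gamma>]) auto
    ultimately show ?case
      using insert component_closed[OF assms(1)] by (auto intro!: add finsum_closed)
  qed
  from this[OF component(2)[OF assms(1)]] show ?thesis
    using component(3)[OF assms(1)] by simp
qed

text \<open>Closure under components provides the decomposition inside \<open>I\<close>; its
  uniqueness is inherited from the whole ring.\<close>

lemma homogeneous_idealI:
  assumes "ideal I R" and closed: "\<And>x \<gamma>. x \<in> I \<Longrightarrow> \<gamma> \<in> carrier \<Gamma> \<Longrightarrow> component x \<gamma> \<in> I"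
  shows "homogeneous_ideal \<Gamma> R Rg I"
  unfolding homogeneous_ideal_def internal_direct_sum_def
proof (intro conjI ballI)
  interpret I: ideal I R by fact
  show "additive_subgroup I R" "ideal I R"
    by (rule I.additive_subgroup_axioms I.ideal_axioms)+
  fix \<gamma> assume \<gamma>: "\<gamma> \<in> carrier \<Gamma>"
  interpret Rg: additive_subgroup "Rg \<gamma>" R by (rule Rg_subgroup[OF \<gamma>])
  show "additive_subgroup (I \<inter> Rg \<gamma>) R"
    by (intro additive_subgroup.intro add.subgroups_Inter_pair I.a_subgroup Rg.a_subgroup)
next
  interpret I: ideal I R by fact
  fix x assume x: "x \<in> I"
  then have xR: "x \<in> carrier R"
    by (rule I.a_Hcarr)
  show "\<exists>!c. c \<in> (\<Pi>\<^sub>E \<gamma>\<in>carrier \<Gamma>. I \<inter> Rg \<gamma>) \<and> finite {\<gamma> \<in> carrier \<Gamma>. c \<gamma> \<noteq> \<zero>} \<and>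
    x = (\<Oplus>\<gamma>\<in>{\<gamma> \<in> carrier \<Gamma>. c \<gamma> \<noteq> \<zero>}. c \<gamma>)"
  proof (rule ex1I[of _ "component x"])
    fix c assume "c \<in> (\<Pi>\<^sub>E \<gamma>\<in>carrier \<Gamma>. I \<inter> Rg \<gamma>) \<and> finite {\<gamma> \<in> carrier \<Gamma>. c \<gamma> \<noteq> \<zero>} \<and>
      x = (\<Oplus>\<gamma>\<in>{\<gamma> \<in> carrier \<Gamma>. c \<gamma> \<noteq> \<zero>}. c \<gamma>)"
    then show "c = component x"
      by (intro component_unique[symmetric, of _ "{\<gamma> \<in> carrier \<Gamma>. c \<gamma> \<noteq> \<zero>}"]) (auto simp: PiE_iff)
  qed (use component[OF xR] closed[OF x] in \<open>auto simp: PiE_iff\<close>)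
qed auto

end

section \<open>Homogeneous components of multiplication operators\<close>

context graded_algebra
begin

text \<open>By additivity \<open>f\<close> may be taken to be \<open>x \<mapsto> a x b\<close> with homogeneous \<open>a\<close> and \<open>b\<close>. As \<open>\<Gamma>\<close> is
  commutative, this operator shifts all degrees by the same amount.\<close>

lemma mult_ops_component:
  assumes "f \<in> mult_ops" "\<gamma> \<in> carrier \<Gamma>"
  shows "\<exists>g\<in>mult_ops. \<forall>\<delta>\<in>carrier \<Gamma>. \<forall>x\<in>Ag \<delta>. g x = A.component (f x) (\<gamma> \<otimes>\<^bsub>\<Gamma>\<^esub> \<delta>)"
    (is "?P f")
proof -
  \<comment> \<open>This serves three times: for sums of operators, and for splitting
    \<open>a\<close> and \<open>b\<close> into homogeneous summands.\<close>
  have P_add: "?P (\<lambda>x\<in>carrier A. f x \<oplus>\<^bsub>A\<^esub> g x)"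
    if fg: "f \<in> mult_ops" "g \<in> mult_ops" and P: "?P f" "?P g" for f g
  proof -
    obtain f' g' where "f' \<in> mult_ops" "g' \<in> mult_ops"
      and "\<forall>\<delta>\<in>carrier \<Gamma>. \<forall>x\<in>Ag \<delta>. f' x = A.component (f x) (\<gamma> \<otimes>\<^bsub>\<Gamma>\<^esub> \<delta>)"
      and "\<forall>\<delta>\<in>carrier \<Gamma>. \<forall>x\<in>Ag \<delta>. g' x = A.component (g x) (\<gamma> \<otimes>\<^bsub>\<Gamma>\<^esub> \<delta>)"
      using P by blast
    then show ?thesis
      using fg assms(2)
      by (intro bexI[of _ "\<lambda>x\<in>carrier A. f' x \<oplus>\<^bsub>A\<^esub> g' x"] mult_ops.add)
        (auto simp: A.Rg_closed A.component_add mult_ops_closed)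
  qed
  from assms(1) show ?thesis
  proof induction
    case (two_sided a b)
    from two_sided(1) show ?case
    proof (induction a rule: A.homogeneous_induct)
      case (homogeneous \<alpha> a)
      from two_sided(2) show ?case
      proof (induction b rule: A.homogeneous_induct)
        case h: (homogeneous \<beta> b)
        have ab: "a \<in> carrier A" "b \<in> carrier A"
          using homogeneous h A.Rg_closed by auto
        have deg: "two_sided a b x \<in> Ag (\<alpha> \<otimes>\<^bsub>\<Gamma>\<^esub> \<beta> \<otimes>\<^bsub>\<Gamma>\<^esub> \<delta>)" "x \<in> carrier A"
          if "\<delta> \<in> carrier \<Gamma>" "x \<in> Ag \<delta>" for x \<delta>
        proof -
          show "x \<in> carrier A"
            using that A.Rg_closed by auto
          moreover have "a \<otimes>\<^bsub>A\<^esub> x \<otimes>\<^bsub>A\<^esub> b \<in> Ag (\<alpha> \<otimes>\<^bsub>\<Gamma>\<^esub> \<delta> \<otimes>\<^bsub>\<Gamma>\<^esub> \<beta>)"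
            using homogeneous h that by (intro A.grading_mult R.Gam.m_closed)
          moreover have "\<alpha> \<otimes>\<^bsub>\<Gamma>\<^esub> \<delta> \<otimes>\<^bsub>\<Gamma>\<^esub> \<beta> = \<alpha> \<otimes>\<^bsub>\<Gamma>\<^esub> \<beta> \<otimes>\<^bsub>\<Gamma>\<^esub> \<delta>"
            using homogeneous h that by (simp add: R.Gam.m_ac)
          ultimately show "two_sided a b x \<in> Ag (\<alpha> \<otimes>\<^bsub>\<Gamma>\<^esub> \<beta> \<otimes>\<^bsub>\<Gamma>\<^esub> \<delta>)"
            by simp
        qed
        \<comment> \<open>The image has degree \<alpha>\<beta>\<delta>, and cancelling \<delta>
          makes the case distinction independent of \<open>x\<close>. So one operator,
          \<open>two_sided a b\<close> or zero, serves for all degrees \<delta>.\<close>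
        have comp: "A.component (two_sided a b x) (\<gamma> \<otimes>\<^bsub>\<Gamma>\<^esub> \<delta>) =
            (if \<gamma> = \<alpha> \<otimes>\<^bsub>\<Gamma>\<^esub> \<beta> then two_sided a b x else \<zero>\<^bsub>A\<^esub>)"
          if "\<delta> \<in> carrier \<Gamma>" "x \<in> Ag \<delta>" for x \<delta>
          using A.component_homogeneous[OF _ deg(1)[OF that]] that homogeneous h assms(2)
          by simp
        show ?case
        proof (cases "\<gamma> = \<alpha> \<otimes>\<^bsub>\<Gamma>\<^esub> \<beta>")
          case True
          then show ?thesis
            using comp mult_ops.two_sided[OF ab] by (intro bexI[of _ "two_sided a b"]) auto
        next
          case False
          then show ?thesis
            using comp deg(2) mult_ops_zero by (intro bexI[of _ "\<lambda>x\<in>carrier A. \<zero>\<^bsub>A\<^esub>"]) auto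
        qed
      next
        case (add b b')
        have a: "a \<in> carrier A"
          using homogeneous A.Rg_closed by auto
        have "two_sided a (b \<oplus>\<^bsub>A\<^esub> b') = (\<lambda>x\<in>carrier A. two_sided a b x \<oplus>\<^bsub>A\<^esub> two_sided a b' x)"
          using a add by (auto simp: A.r_distr)
        moreover have "?P (\<lambda>x\<in>carrier A. two_sided a b x \<oplus>\<^bsub>A\<^esub> two_sided a b' x)"
          by (rule P_add) (use a add in \<open>blast intro: mult_ops.two_sided\<close>)+
        ultimately show ?case
          by (simp only:)
      qed
    next
      case (add a a')
      have "two_sided (a \<oplus>\<^bsub>A\<^esub> a') b = (\<lambda>x\<in>carrier A. two_sided a b x \<oplus>\<^bsub>A\<^esub> two_sided a' b x)"
        using two_sided(2) add by (auto simp: A.l_distr)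
      moreover have "?P (\<lambda>x\<in>carrier A. two_sided a b x \<oplus>\<^bsub>A\<^esub> two_sided a' b x)"
        by (rule P_add) (use two_sided(2) add in \<open>blast intro: mult_ops.two_sided\<close>)+
      ultimately show ?case
        by (simp only:)
    qed
  qed (rule P_add)
qed

end

section \<open>Graded density and conclusion\<close>

context graded_central_simple_algebra
begin

lemma central_imp_scalar:
  assumes "z \<in> carrier A" "\<And>a. a \<in> carrier A \<Longrightarrow> a \<otimes>\<^bsub>A\<^esub> z = z \<otimes>\<^bsub>A\<^esub> a"
  shows "\<exists>r\<in>carrier R. z = r \<odot>\<^bsub>A\<^esub> \<one>\<^bsub>A\<^esub>"
proof -
  have "z \<in> ring_center A"
    using assms by (auto simp: ring_center_def)
  moreover have "structure_map A ` carrier R = ring_center A"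
    using center_iso by (auto simp: graded_ring_isos_def ring_iso_def bij_betw_def center_ring_def)
  ultimately show ?thesis
    unfolding structure_map_def by blast
qed

text \<open>A scalar annihilating the algebra kills 1, and the structure map is injective.\<close>

lemma faithful: "faithful_module R A"
  unfolding faithful_module_def
proof (intro ballI impI)
  fix r assume r: "r \<in> carrier R" "\<forall>x\<in>carrier A. r \<odot>\<^bsub>A\<^esub> x = \<zero>\<^bsub>A\<^esub>"
  have "inj_on (structure_map A) (carrier R)"
    using center_iso by (auto simp: graded_ring_isos_def ring_iso_def bij_betw_def)
  moreover have "structure_map A r = structure_map A \<zero>"
    using r by (simp add: structure_map_def)
  ultimately show "r = \<zero>"
    using r by (auto dest: inj_onD)
qed

text \<open>Passing from \<open>B\<close> to subsets \<open>S\<close> makes room for induction;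
  \<open>b\<close> stays arbitrary because the induction hypothesis is applied at every element of
  \<open>S - {b}\<close>.\<close>

lemma dual_operators:
  assumes basis: "module_basis R A B" "finite B" and hom: "B \<subseteq> homogeneous_elements \<Gamma> Ag"
    and "S \<subseteq> B" "b \<in> S"
  shows "\<exists>T\<in>mult_ops. T b = \<one>\<^bsub>A\<^esub> \<and> (\<forall>b'\<in>S - {b}. T b' = \<zero>\<^bsub>A\<^esub>)"
  using finite_subset[OF \<open>S \<subseteq> B\<close> \<open>finite B\<close>] assms(4,5)
proof (induction S arbitrary: b rule: finite_psubset_induct)
  case (psubset S)
  have sub: "B \<subseteq> carrier A"
    by (rule basis_closed[OF basis])
  let ?S = "S - {b}"
  have b: "b \<in> B" "b \<in> carrier A" and S: "finite ?S" "?S \<subseteq> B" "?S \<subseteq> carrier A"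
    using psubset sub by auto
  \<comment> \<open>The claim for \<open>S\<close> and \<open>b\<close> says exactly that 1 lies in
    \<open>I\<close>.\<close>
  define I where "I = {T b | T. T \<in> mult_ops \<and> (\<forall>b'\<in>?S. T b' = \<zero>\<^bsub>A\<^esub>)}"
  have I: "T b \<in> I" if "T \<in> mult_ops" "\<forall>b'\<in>?S. T b' = \<zero>\<^bsub>A\<^esub>" for T
    using that by (auto simp: I_def)
  have IE: "\<exists>T\<in>mult_ops. x = T b \<and> (\<forall>b'\<in>?S. T b' = \<zero>\<^bsub>A\<^esub>)" if "x \<in> I" for x
    using that by (auto simp: I_def)
  \<comment> \<open>Two-sided multiplication at once gives both ideal laws, with u or v equal to 1,
    and negatives, with u = -1.\<close>
  have mult_I: "u \<otimes>\<^bsub>A\<^esub> x \<otimes>\<^bsub>A\<^esub> v \<in> I" if "x \<in> I" "u \<in> carrier A" "v \<in> carrier A" for u v x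
  proof -
    obtain T where "T \<in> mult_ops" "x = T b" "\<forall>b'\<in>?S. T b' = \<zero>\<^bsub>A\<^esub>"
      using IE[OF \<open>x \<in> I\<close>] by blast
    moreover from this have "\<forall>b'\<in>?S. (\<lambda>x\<in>carrier A. u \<otimes>\<^bsub>A\<^esub> T x \<otimes>\<^bsub>A\<^esub> v) b' = \<zero>\<^bsub>A\<^esub>"
      using that S(3) by (auto simp: subset_iff)
    ultimately show ?thesis
      using I[OF mult_ops_mult[of T u v]] that b by simp
  qed
  have I_sub: "I \<subseteq> carrier A"
    using b by (auto simp: I_def mult_ops_closed)
  have "ideal I A"
  proof (rule idealI)
    show "ring A" ..
    show "subgroup I (add_monoid A)"
    proof (rule A.add.subgroupI)
      show "I \<subseteq> carrier A" by (rule I_sub)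
      show "I \<noteq> {}"
        using I[OF mult_ops_zero] S(3) by (force simp: subset_iff)
      show "\<ominus>\<^bsub>A\<^esub> x \<in> I" if "x \<in> I" for x
        using mult_I[OF that, of "\<ominus>\<^bsub>A\<^esub> \<one>\<^bsub>A\<^esub>" "\<one>\<^bsub>A\<^esub>"] that I_sub by (auto simp: A.l_minus subset_iff)
      fix x y assume "x \<in> I" "y \<in> I"
      then obtain T U where "T \<in> mult_ops" "x = T b" "\<forall>b'\<in>?S. T b' = \<zero>\<^bsub>A\<^esub>"
          "U \<in> mult_ops" "y = U b" "\<forall>b'\<in>?S. U b' = \<zero>\<^bsub>A\<^esub>"
        using IE by meson
      moreover from this have "\<forall>b'\<in>?S. (\<lambda>x\<in>carrier A. T x \<oplus>\<^bsub>A\<^esub> U x) b' = \<zero>\<^bsub>A\<^esub>"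
        using S(3) by (auto simp: subset_iff)
      ultimately show "x \<oplus>\<^bsub>A\<^esub> y \<in> I"
        using I[OF mult_ops.add[of T U]] b by simp
    qed
    show "u \<otimes>\<^bsub>A\<^esub> x \<in> I" "x \<otimes>\<^bsub>A\<^esub> u \<in> I" if "x \<in> I" "u \<in> carrier A" for x u
      using mult_I[OF that(1), of u "\<one>\<^bsub>A\<^esub>"] mult_I[OF that(1), of "\<one>\<^bsub>A\<^esub>" u] that I_sub by auto
  qed
  then have "homogeneous_ideal \<Gamma> A Ag I"
  proof (rule A.homogeneous_idealI)
    fix x \<gamma> assume x: "x \<in> I" and \<gamma>: "\<gamma> \<in> carrier \<Gamma>"
    obtain T where T: "T \<in> mult_ops" "x = T b" "\<forall>b'\<in>?S. T b' = \<zero>\<^bsub>A\<^esub>"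
      using IE[OF x] by blast
    obtain \<beta> where \<beta>: "\<beta> \<in> carrier \<Gamma>" "b \<in> Ag \<beta>"
      using b hom by (auto simp: homogeneous_elements_def)
    \<comment> \<open>Take the part of \<open>T\<close> that shifts degrees by \<gamma>\<beta>^-1:
      as \<open>b\<close> has degree \<beta>, its value there is the component of \<open>T b\<close>
      in degree \<gamma>. It still kills \<open>S - {b}\<close>, whose elements are homogeneous,
      since components of 0 are 0.\<close>
    obtain U where U: "U \<in> mult_ops"
      "\<And>\<delta> x. \<delta> \<in> carrier \<Gamma> \<Longrightarrow> x \<in> Ag \<delta> \<Longrightarrow>
        U x = A.component (T x) (\<gamma> \<otimes>\<^bsub>\<Gamma>\<^esub> inv\<^bsub>\<Gamma>\<^esub> \<beta> \<otimes>\<^bsub>\<Gamma>\<^esub> \<delta>)"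
      using mult_ops_component[OF T(1), of "\<gamma> \<otimes>\<^bsub>\<Gamma>\<^esub> inv\<^bsub>\<Gamma>\<^esub> \<beta>"] \<gamma> \<beta> by auto
    have "U b = A.component x \<gamma>"
      using U(2)[OF \<beta>] \<gamma> \<beta> T(2) by (simp add: R.Gam.m_assoc)
    moreover have "U b' = \<zero>\<^bsub>A\<^esub>" if b': "b' \<in> ?S" for b'
    proof -
      obtain \<delta> where \<delta>: "\<delta> \<in> carrier \<Gamma>" "b' \<in> Ag \<delta>"
        using b' S hom by (auto simp: homogeneous_elements_def)
      then show ?thesis
        using U(2)[OF \<delta>] T(3) b' \<gamma> \<beta> A.component_homogeneous[OF \<delta>(1) A.Rg_zero[OF \<delta>(1)]] by simp
    qed
    ultimately show "A.component x \<gamma> \<in> I"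
      using I[OF U(1)] by metis
  qed
  then consider "I = {\<zero>\<^bsub>A\<^esub>}" | "I = carrier A"
    using A.homogeneous_ideal_trivial by blast
  then have "\<one>\<^bsub>A\<^esub> \<in> I"
  proof cases
    case 1
    \<comment> \<open>With \<open>I\<close> zero, every operator that vanishes on
      \<open>S - {b}\<close> vanishes at \<open>b\<close> too. This is applied to two operators
      below.\<close>
    then have kill: "T b = \<zero>\<^bsub>A\<^esub>" if "T \<in> mult_ops" "\<forall>b'\<in>?S. T b' = \<zero>\<^bsub>A\<^esub>" for T
      using I[OF that] by simp
    have "\<forall>s\<in>?S. \<exists>T. T \<in> mult_ops \<and> T s = \<one>\<^bsub>A\<^esub> \<and> (\<forall>b'\<in>?S - {s}. T b' = \<zero>\<^bsub>A\<^esub>)"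
    proof
      fix s assume "s \<in> ?S"
      then show "\<exists>T. T \<in> mult_ops \<and> T s = \<one>\<^bsub>A\<^esub> \<and> (\<forall>b'\<in>?S - {s}. T b' = \<zero>\<^bsub>A\<^esub>)"
        using psubset.IH[of ?S s] psubset.prems by blast
    qed
    from bchoice[OF this] obtain T where dual: "\<forall>s\<in>?S. T s \<in> mult_ops \<and> T s s = \<one>\<^bsub>A\<^esub> \<and>
        (\<forall>b'\<in>?S - {s}. T s b' = \<zero>\<^bsub>A\<^esub>)" ..
    have T: "T s \<in> mult_ops" "T s s = \<one>\<^bsub>A\<^esub>" "\<And>s'. s' \<in> ?S - {s} \<Longrightarrow> T s s' = \<zero>\<^bsub>A\<^esub>"
      if "s \<in> ?S" for s
      using bspec[OF dual that] by blast+
    have "\<exists>r\<in>carrier R. T s b = r \<odot>\<^bsub>A\<^esub> \<one>\<^bsub>A\<^esub>" if s: "s \<in> ?S" for s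
    proof (rule central_imp_scalar)
      show z: "T s b \<in> carrier A"
        by (rule mult_ops_closed[OF T(1)[OF s] b(2)])
      fix a assume a: "a \<in> carrier A"
      \<comment> \<open>The commutator of \<open>a\<close> with \<open>T s\<close>. On
        \<open>S - {b}\<close> the values of \<open>T s\<close> are 0 and 1, which commute with
        \<open>a\<close>, so \<open>kill\<close> applies and shows that \<open>T s b\<close>
        commutes with \<open>a\<close>.\<close>
      let ?C = "\<lambda>x\<in>carrier A. (\<lambda>x\<in>carrier A. a \<otimes>\<^bsub>A\<^esub> T s x \<otimes>\<^bsub>A\<^esub> \<one>\<^bsub>A\<^esub>) x \<ominus>\<^bsub>A\<^esub>
        (\<lambda>x\<in>carrier A. \<one>\<^bsub>A\<^esub> \<otimes>\<^bsub>A\<^esub> T s x \<otimes>\<^bsub>A\<^esub> a) x"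
      have "?C \<in> mult_ops"
        using T(1)[OF s] a by (intro mult_ops_diff mult_ops_mult) auto
      moreover have "?C b' = \<zero>\<^bsub>A\<^esub>" if "b' \<in> ?S" for b'
        using that S(3) T(2)[OF s] T(3)[OF s, of b'] a
        by (cases "b' = s") (auto simp: A.minus_eq A.r_neg subset_iff)
      ultimately have "?C b = \<zero>\<^bsub>A\<^esub>"
        by (rule kill[OF _ ballI])
      then have "a \<otimes>\<^bsub>A\<^esub> T s b \<ominus>\<^bsub>A\<^esub> T s b \<otimes>\<^bsub>A\<^esub> a = \<zero>\<^bsub>A\<^esub>"
        using a z b by simp
      then show "a \<otimes>\<^bsub>A\<^esub> T s b = T s b \<otimes>\<^bsub>A\<^esub> a"
        using a z by simp
    qed
    then obtain r where r: "\<And>s. s \<in> ?S \<Longrightarrow> r s \<in> carrier R" "\<And>s. s \<in> ?S \<Longrightarrow> T s b = r s \<odot>\<^bsub>A\<^esub> \<one>\<^bsub>A\<^esub>"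
      by metis
    \<comment> \<open>The operator id - \<Sum> s T(s) vanishes on \<open>S - {b}\<close> by duality.
      Its vanishing at \<open>b\<close> then expresses \<open>b\<close> through the other elements
      of \<open>S\<close>, with scalar coefficients.\<close>
    let ?D = "\<lambda>x\<in>carrier A. (\<lambda>x\<in>carrier A. x) x \<ominus>\<^bsub>A\<^esub>
      (\<lambda>x\<in>carrier A. \<Oplus>\<^bsub>A\<^esub>s\<in>?S. (\<lambda>x\<in>carrier A. s \<otimes>\<^bsub>A\<^esub> T s x \<otimes>\<^bsub>A\<^esub> \<one>\<^bsub>A\<^esub>) x) x"
    have "?D \<in> mult_ops"
      using T(1) S by (intro mult_ops_diff mult_ops_id mult_ops_finsum mult_ops_mult) auto
    moreover have "?D b' = \<zero>\<^bsub>A\<^esub>" if b': "b' \<in> ?S" for b'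
    proof -
      have "(\<Oplus>\<^bsub>A\<^esub>s\<in>?S. s \<otimes>\<^bsub>A\<^esub> T s b' \<otimes>\<^bsub>A\<^esub> \<one>\<^bsub>A\<^esub>) = (\<Oplus>\<^bsub>A\<^esub>s\<in>?S. if b' = s then s else \<zero>\<^bsub>A\<^esub>)"
        using T(2,3) S(3) b' by (intro A.finsum_cong') (auto simp: subset_iff)
      also have "\<dots> = b'"
        using b' S by (intro A.add.finprod_singleton) auto
      finally show ?thesis
        using b' S(3) by (auto simp: A.minus_eq A.r_neg subset_iff)
    qed
    ultimately have "?D b = \<zero>\<^bsub>A\<^esub>"
      by (rule kill[OF _ ballI])
    moreover have "(\<Oplus>\<^bsub>A\<^esub>s\<in>?S. s \<otimes>\<^bsub>A\<^esub> T s b \<otimes>\<^bsub>A\<^esub> \<one>\<^bsub>A\<^esub>) = (\<Oplus>\<^bsub>A\<^esub>s\<in>?S. r s \<odot>\<^bsub>A\<^esub> s)"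
      using r S(3) by (intro A.finsum_cong') (auto simp: smult_mult_right subset_iff)
    moreover have rS: "(\<Oplus>\<^bsub>A\<^esub>s\<in>?S. r s \<odot>\<^bsub>A\<^esub> s) \<in> carrier A"
      using r S(3) by (intro A.finsum_closed) auto
    ultimately have b_eq: "b = (\<Oplus>\<^bsub>A\<^esub>s\<in>?S. r s \<odot>\<^bsub>A\<^esub> s)"
      using b by simp
    \<comment> \<open>Two coordinate families for the same element \<open>b\<close>: at the index
      \<open>b\<close> itself the first is 0 and the second is 1.\<close>
    let ?r = "\<lambda>s\<in>B. if s \<in> ?S then r s else \<zero>" and ?e = "\<lambda>s\<in>B. if s = b then \<one> else \<zero>"
    have "(\<Oplus>\<^bsub>A\<^esub>s\<in>?S. r s \<odot>\<^bsub>A\<^esub> s) = (\<Oplus>\<^bsub>A\<^esub>s\<in>B. ?r s \<odot>\<^bsub>A\<^esub> s)"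
      using basis(2) S r sub by (intro A.add.finprod_mono_neutral_cong_left) (auto simp: subset_iff)
    then have coords_r: "coords B b = ?r"
      using coords_unique[OF basis, of ?r] b_eq r by auto
    have "(\<Oplus>\<^bsub>A\<^esub>s\<in>{b}. s) = (\<Oplus>\<^bsub>A\<^esub>s\<in>B. ?e s \<odot>\<^bsub>A\<^esub> s)"
      using basis(2) b sub by (intro A.add.finprod_mono_neutral_cong_left) (auto simp: subset_iff)
    then have "coords B b = ?e"
      using coords_unique[OF basis, of ?e] b by auto
    with coords_r have "?r b = ?e b"
      by metis
    then have "\<zero> = \<one>"
      using b by simp
    \<comment> \<open>There is no appeal to non-triviality: if 0 = 1 in the base ring, the algebra
      is zero as well, and its 1 lies in the zero ideal.\<close>
    then have "\<one>\<^bsub>A\<^esub> = \<zero>\<^bsub>A\<^esub>"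
      by (metis A.one_closed smult_one smult_l_null)
    with 1 show ?thesis
      by simp
  qed auto
  then show ?case
    using IE by metis
qed

lemma azumaya: "azumaya_algebra R A"
proof -
  obtain B where B: "finite B" "B \<subseteq> homogeneous_elements \<Gamma> Ag" "module_basis R A B"
    using finite_dimension unfolding finite_graded_dimension_def by blast
  show ?thesis
    by (rule azumaya_of_dual_basis[OF B(3,1) dual_operators[OF B(3,1,2) order_refl] faithful])
qed

end

theorem theorem4p3p3:
  fixes \<Gamma> :: "('g, 'h) monoid_scheme"
    and R :: "('r, 'k) ring_scheme" and Rg :: "'g \<Rightarrow> 'r set"
    and A :: "('r, 'a, 'm) module_scheme" and Ag :: "'g \<Rightarrow> 'a set"
  assumes "comm_group \<Gamma>"
    and "graded_field \<Gamma> R Rg"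
    and "graded_central_simple_algebra \<Gamma> R Rg A Ag"
  shows "azumaya_algebra R A"
  using assms(3) by (rule graded_central_simple_algebra.azumaya)

end
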